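(* The variety $J^2$ has exactly three open components, i.e. there are exactly three $GL(2,\mathbb{R})$-orbits that are open in $J^2$; two of them have dimension $4$ and one has dimension $2$. Every law in $J^2$ that does not belong to one of these open orbits is a contraction of a (rigid) law belonging to one of them.
   Context: $J^n$ is the set of Jordan algebra laws on $\mathbb{R}^n$, i.e. symmetric bilinear maps $\varphi:\mathbb{R}^n\times\mathbb{R}^n\to\mathbb{R}^n$ with $\varphi(\varphi(X,X),\varphi(X,Y))=\varphi(X,\varphi(\varphi(X,X),Y))$ for all $X,Y$. For $n=2$, $J^2$ is a real algebraic subset of the space $\mathbb{R}^6$ of structure constants, with the induced Euclidean topology. $GL(n,\mathbb{R})$ acts on $J^n$ by $(\varphi,f)\mapsto f^{-1}\circ\varphi\circ(f,f)$; orbits are the isomorphism classes, and the dimension of an orbit is its dimension as a smooth manifold (homogeneous space). A law is rigid if its orbit is open in $J^n$. Given $\varphi\in J^n$ and a family $f_t\in GL(n,\mathbb{R})$ depending on a continuous parameter $t>0$, if the limit $\varphi'(X,Y)=\lim_{t\to0}f_t^{-1}(\varphi(f_t(X),f_t(Y)))$ exists for all $X,Y\in\mathbb{R}^n$, then $\varphi'\in J^n$ is called a contraction of $\varphi$. *)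

theory Defs
  imports "HOL-Analysis.Analysis"
begin

definition jordan_laws :: "(real^'n \<Rightarrow> real^'n \<Rightarrow> real^'n) set" where
  "jordan_laws = {\<phi>. bilinear \<phi> \<and> (\<forall>X Y. \<phi> X Y = \<phi> Y X) \<and>
     (\<forall>X Y. \<phi> (\<phi> X X) (\<phi> X Y) = \<phi> X (\<phi> (\<phi> X X) Y))}"

definition gl_act ::
  "real^'n^'n \<Rightarrow> (real^'n \<Rightarrow> real^'n \<Rightarrow> real^'n) \<Rightarrow> real^'n \<Rightarrow> real^'n \<Rightarrow> real^'n" where
  "gl_act f \<phi> = (\<lambda>X Y. matrix_inv f *v \<phi> (f *v X) (f *v Y))"

definition gl_orbit ::
  "(real^'n \<Rightarrow> real^'n \<Rightarrow> real^'n) \<Rightarrow> (real^'n \<Rightarrow> real^'n \<Rightarrow> real^'n) set" where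
  "gl_orbit \<phi> = {gl_act f \<phi> |f. invertible f}"

text \<open>\<open>is_contraction \<phi>' \<phi>\<close>: the law \<open>\<phi>'\<close> is a contraction of \<open>\<phi>\<close>. The family \<open>f\<close> is only
  relevant for positive parameters, where it has to be continuous.\<close>

definition is_contraction ::
  "(real^'n \<Rightarrow> real^'n \<Rightarrow> real^'n) \<Rightarrow> (real^'n \<Rightarrow> real^'n \<Rightarrow> real^'n) \<Rightarrow> bool" where
  "is_contraction \<phi>' \<phi> \<longleftrightarrow> \<phi> \<in> jordan_laws \<and>
     (\<exists>f :: real \<Rightarrow> real^'n^'n.
        continuous_on {0<..} f \<and> (\<forall>t>0. invertible (f t)) \<and>
        (\<forall>X Y. ((\<lambda>t. gl_act (f t) \<phi> X Y) \<longlongrightarrow> \<phi>' X Y) (at_right 0)))"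

text \<open>The structure constants of a commutative law on \<open>\<real>\<^sup>2\<close>: the coordinates of
  \<open>e\<^sub>1e\<^sub>1\<close>, \<open>e\<^sub>1e\<^sub>2\<close> and \<open>e\<^sub>2e\<^sub>2\<close>, as a point of \<open>\<real>\<^sup>6 = \<real>\<^sup>2 \<times> \<real>\<^sup>2 \<times> \<real>\<^sup>2\<close>.\<close>

type_synonym R6 = "(real^2) \<times> (real^2) \<times> (real^2)"

definition structure_constants :: "(real^2 \<Rightarrow> real^2 \<Rightarrow> real^2) \<Rightarrow> R6" where
  "structure_constants \<phi> =
     (\<phi> (axis 1 1) (axis 1 1), \<phi> (axis 1 1) (axis 2 1), \<phi> (axis 2 1) (axis 2 1))"

definition jordan2_topology :: "(real^2 \<Rightarrow> real^2 \<Rightarrow> real^2) topology" where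
  "jordan2_topology = pullback_topology jordan_laws structure_constants euclidean"

definition rigid :: "(real^2 \<Rightarrow> real^2 \<Rightarrow> real^2) \<Rightarrow> bool" where
  "rigid \<phi> \<longleftrightarrow> \<phi> \<in> jordan_laws \<and> openin jordan2_topology (gl_orbit \<phi>)"

definition open_orbits :: "(real^2 \<Rightarrow> real^2 \<Rightarrow> real^2) set set" where
  "open_orbits = {gl_orbit \<phi> |\<phi>. \<phi> \<in> jordan_laws \<and> openin jordan2_topology (gl_orbit \<phi>)}"

text \<open>\<open>Ck_on k f U\<close>, for open \<open>U\<close>: the map \<open>f\<close> is \<open>k\<close> times continuously differentiable on \<open>U\<close>.\<close>

primrec Ck_on ::
  "nat \<Rightarrow> ('a::euclidean_space \<Rightarrow> 'b::euclidean_space) \<Rightarrow> 'a set \<Rightarrow> bool" where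
  "Ck_on 0 f U \<longleftrightarrow> continuous_on U f"
| "Ck_on (Suc k) f U \<longleftrightarrow> (\<forall>x\<in>U. f differentiable (at x)) \<and>
     (\<forall>v. Ck_on k (\<lambda>x. frechet_derivative f (at x) v) U)"

definition smooth_on :: "('a::euclidean_space \<Rightarrow> 'b::euclidean_space) \<Rightarrow> 'a set \<Rightarrow> bool" where
  "smooth_on f U \<longleftrightarrow> (\<forall>k. Ck_on k f U)"

text \<open>Embedded smooth submanifolds of dimension \<open>d\<close>, by slice charts: around each point of \<open>M\<close>
  there is a diffeomorphism \<open>\<Phi>\<close> between open sets of the ambient space, with inverse \<open>\<Psi>\<close>,
  that takes \<open>M\<close> to a \<open>d\<close>-dimensional linear subspace.\<close>

definition smooth_submanifold :: "nat \<Rightarrow> 'a::euclidean_space set \<Rightarrow> bool" where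
  "smooth_submanifold d M \<longleftrightarrow>
     (\<forall>p\<in>M. \<exists>V W (\<Phi> :: 'a \<Rightarrow> 'a) \<Psi> S.
        open V \<and> p \<in> V \<and> open W \<and> smooth_on \<Phi> V \<and> smooth_on \<Psi> W \<and>
        \<Phi> ` V = W \<and> \<Psi> ` W = V \<and>
        (\<forall>x\<in>V. \<Psi> (\<Phi> x) = x) \<and> (\<forall>y\<in>W. \<Phi> (\<Psi> y) = y) \<and>
        subspace S \<and> dim S = d \<and> \<Phi> ` (M \<inter> V) = S \<inter> W)"

text \<open>Orbits of the (algebraic) action are locally closed, so that the manifold structure of the
  homogeneous space is the one induced from the space of structure constants.\<close>

definition has_orbit_dim :: "(real^2 \<Rightarrow> real^2 \<Rightarrow> real^2) set \<Rightarrow> nat \<Rightarrow> bool" where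
  "has_orbit_dim C d \<longleftrightarrow> smooth_submanifold d (structure_constants ` C)"

end

theory Submission
  imports Defs
begin

text \<open>
  Let \<open>A\<close> and \<open>B\<close> be the multiplication operators of the two basis vectors. If \<open>X = (x, y)\<close> and
  \<open>X\<^sup>2 = (z, w)\<close>, then the commutator of the multiplications by \<open>X\<^sup>2\<close> and \<open>X\<close> is \<open>(zy - wx)[A, B]\<close>.
  Hence a law on the plane is Jordan iff it is associative (\<open>[A, B] = 0\<close>) or \<open>X\<^sup>2\<close> is always a
  multiple of \<open>X\<close>; the latter laws form a plane in \<open>\<real>\<^sup>6\<close>, and they are associative only at \<open>0\<close>.
  The associative laws are those for which a certain \<open>2 \<times> 3\<close> matrix of linear forms in the structure
  constants has rank at most 1; away from \<open>0\<close> they form a 4-dimensional manifold.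

  The discriminant of the trace form is multiplied by a positive number under a change of basis.
  A nonzero associative law has a basis \<open>X, X\<^sup>2\<close>, with \<open>X\<^sup>3 = m X\<^sup>2 + n X\<close>, and its discriminant has
  the sign of \<open>n\<^sup>2 (m\<^sup>2 + 4n)\<close>. Depending on the roots of \<open>x\<^sup>2 - m x - n\<close> the algebra is \<open>\<real> \<times> \<real>\<close>
  (positive sign), \<open>\<complex>\<close> (negative sign), or, when a root vanishes or the roots coincide, a limit
  of copies of \<open>\<real> \<times> \<real>\<close>, obtained by moving the roots apart and away from \<open>0\<close>. So the open orbits are
  given by positive discriminant, by negative discriminant, and by nonassociativity.
\<close>

subsection \<open>Plane Jordan laws\<close>

text \<open>Inverse of \<open>structure_constants\<close> on commutative bilinear laws. It is
  defined on all of \<open>R6\<close>, so that conditions on laws become polynomial conditions on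
  points.\<close>

definition law :: "R6 \<Rightarrow> real^2 \<Rightarrow> real^2 \<Rightarrow> real^2" where
  "law s X Y = (X$1 * Y$1) *\<^sub>R fst s + (X$1 * Y$2 + X$2 * Y$1) *\<^sub>R fst (snd s)
     + (X$2 * Y$2) *\<^sub>R snd (snd s)"

lemma vec2_eq: "(X :: real^2) = Y \<longleftrightarrow> X$1 = Y$1 \<and> X$2 = Y$2"
  by (simp add: vec_eq_iff forall_2)

lemma law_component:
  "law s X Y $ i = X$1 * Y$1 * fst s $ i + (X$1 * Y$2 + X$2 * Y$1) * fst (snd s) $ i
     + X$2 * Y$2 * snd (snd s) $ i"
  by (simp add: law_def)

lemma bilinear_law: "bilinear (law s)"
  unfolding bilinear_def linear_iff
  by (auto simp: law_def algebra_simps)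

lemma law_commute: "law s X Y = law s Y X"
  by (simp add: law_def algebra_simps)

lemma structure_constants_law [simp]: "structure_constants (law s) = s"
  by (cases s) (simp add: structure_constants_def law_def axis_def)

lemma vec2_expand: "(X :: real^2) = X$1 *\<^sub>R axis 1 1 + X$2 *\<^sub>R axis 2 1"
  by (simp add: vec2_eq axis_def)

lemma bilinear_expand2:
  assumes "bilinear \<phi>" and "\<And>X Y. \<phi> X Y = \<phi> Y X"
  shows "\<phi> (x *\<^sub>R u + y *\<^sub>R v) (z *\<^sub>R u + w *\<^sub>R v)
     = (x * z) *\<^sub>R \<phi> u u + (x * w + y * z) *\<^sub>R \<phi> u v + (y * w) *\<^sub>R \<phi> v v"
  using assms(2)[of v u]
  by (simp add: bilinear_ladd[OF assms(1)] bilinear_radd[OF assms(1)]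
      bilinear_lmul[OF assms(1)] bilinear_rmul[OF assms(1)] algebra_simps)

lemma law_structure_constants:
  assumes "bilinear \<phi>" and "\<And>X Y. \<phi> X Y = \<phi> Y X"
  shows "law (structure_constants \<phi>) = \<phi>"
proof (intro ext)
  fix X Y
  show "law (structure_constants \<phi>) X Y = \<phi> X Y"
    using bilinear_expand2[OF assms, of "X$1" "axis 1 1" "X$2" "axis 2 1" "Y$1" "Y$2"]
    by (simp add: law_def structure_constants_def flip: vec2_expand)
qed

lemma jordan_law_structure_constants:
  "\<phi> \<in> jordan_laws \<Longrightarrow> law (structure_constants \<phi>) = \<phi>"
  by (simp add: jordan_laws_def law_structure_constants)

text \<open>The minors of the matrix with rows \<open>(b, c, d - a)\<close> and \<open>(d, e, f - c)\<close>, where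
  \<open>e\<^sub>1e\<^sub>1 = (a, b)\<close>, \<open>e\<^sub>1e\<^sub>2 = (c, d)\<close> and \<open>e\<^sub>2e\<^sub>2 = (e, f)\<close>. They are the entries of the commutator
  of the multiplication operators of \<open>e\<^sub>1\<close> and \<open>e\<^sub>2\<close>.\<close>

fun assoc_eqs :: "R6 \<Rightarrow> bool" where
  "assoc_eqs (p, q, r) \<longleftrightarrow> p$2 * r$1 = q$1 * q$2 \<and>
     p$2 * (r$2 - q$1) = q$2 * (q$2 - p$1) \<and> q$1 * (r$2 - q$1) = r$1 * (q$2 - p$1)"

text \<open>These are the laws with X^2 = l(X) X for a linear form l, that is XY = (l(X) Y + l(Y) X)
  / 2; here l has the coefficients \<open>p$1\<close> and \<open>r$2\<close>.\<close>

fun half_eqs :: "R6 \<Rightarrow> bool" where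
  "half_eqs (p, q, r) \<longleftrightarrow> p$2 = 0 \<and> r$1 = 0 \<and> p$1 = 2 * q$2 \<and> r$2 = 2 * q$1"

text \<open>For a commutative law, associativity says that multiplications by X and Z commute, and
  by linearity this reduces to the basis vectors. Concretely, each component of the associator lies
  in the ideal generated by the three minors.\<close>

lemma law_assoc:
  assumes "assoc_eqs s"
  shows "law s (law s X Y) Z = law s X (law s Y Z)"
proof -
  obtain p q r where s: "s = (p, q, r)" by (cases s)
  have e: "p$2 * r$1 = q$1 * q$2" "p$2 * (r$2 - q$1) = q$2 * (q$2 - p$1)"
     "q$1 * (r$2 - q$1) = r$1 * (q$2 - p$1)"
    using assms s by auto
  show ?thesis
    unfolding vec2_eq law_component s fst_conv snd_conv
    using e by (intro conjI; algebra)
qed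

text \<open>The wedge of \<open>X\<close> and \<open>X\<^sup>2\<close>, for \<open>X = (x, y)\<close>.\<close>

fun square_wedge :: "R6 \<Rightarrow> real \<Rightarrow> real \<Rightarrow> real" where
  "square_wedge (p, q, r) x y =
     x * (x^2 * p$2 + 2 * x * y * q$2 + y^2 * r$2) - y * (x^2 * p$1 + 2 * x * y * q$1 + y^2 * r$1)"

lemma square_wedge_law:
  "square_wedge s (X$1) (X$2) = X$1 * law s X X $ 2 - X$2 * law s X X $ 1"
  by (cases s) (simp add: law_component algebra_simps power2_eq_square)

text \<open>The wedge is a binary cubic form, and its four coefficients are determined by its values
  at four points. Their vanishing is exactly \<open>half_eqs\<close>.\<close>

lemma square_wedge_zero_imp_half:
  assumes "\<And>x y. square_wedge s x y = 0"
  shows "half_eqs s"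
proof -
  obtain p q r where s: "s = (p, q, r)" by (cases s)
  show ?thesis
    using assms[of 1 0] assms[of 0 1] assms[of 1 1] assms[of 1 "-1"] by (simp add: s)
qed

lemma half_imp_square_wedge_zero: "half_eqs s \<Longrightarrow> square_wedge s x y = 0"
  by (cases s) (simp add: algebra_simps power2_eq_square)

text \<open>Each component of the Jordan defect factors as the cubic form
  \<open>square_wedge\<close> in X times a linear form in Y whose coefficients are minors up to
  sign. If the cubic is nonzero somewhere, evaluating at that X and at the two basis vectors Y makes
  all minors vanish.\<close>

lemma jordan_law_iff: "law s \<in> jordan_laws \<longleftrightarrow> assoc_eqs s \<or> half_eqs s"
proof -
  obtain p q r where s: "s = (p, q, r)" by (cases s)
  define k1 k2 k3 where "k1 = p$2 * r$1 - q$1 * q$2"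
    and "k2 = p$2 * (r$2 - q$1) - q$2 * (q$2 - p$1)"
    and "k3 = q$1 * (r$2 - q$1) - r$1 * (q$2 - p$1)"
  note k_def = k1_def k2_def k3_def
  have k: "assoc_eqs s \<longleftrightarrow> k1 = 0 \<and> k2 = 0 \<and> k3 = 0"
    by (auto simp: s k_def)
  have 1: "law s (law s X X) (law s X Y) $ 1 - law s X (law s (law s X X) Y) $ 1
      = square_wedge s (X$1) (X$2) * (k1 * Y$1 - k3 * Y$2)" for X Y
    unfolding law_component s fst_conv snd_conv k_def square_wedge.simps
    by algebra
  have 2: "law s (law s X X) (law s X Y) $ 2 - law s X (law s (law s X X) Y) $ 2
      = square_wedge s (X$1) (X$2) * (k2 * Y$1 - k1 * Y$2)" for X Y
    unfolding law_component s fst_conv snd_conv k_def square_wedge.simps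
    by algebra
  have J: "law s \<in> jordan_laws \<longleftrightarrow> (\<forall>(X::real^2) (Y::real^2). square_wedge s (X$1) (X$2) * (k1 * Y$1 - k3 * Y$2) = 0 \<and>
      square_wedge s (X$1) (X$2) * (k2 * Y$1 - k1 * Y$2) = 0)"
    unfolding 1[symmetric] 2[symmetric] jordan_laws_def
    using bilinear_law law_commute by (simp add: vec2_eq)
  show ?thesis
  proof
    assume j: "law s \<in> jordan_laws"
    show "assoc_eqs s \<or> half_eqs s"
    proof (rule disjCI)
      assume "\<not> half_eqs s"
      then obtain x y where w: "square_wedge s x y \<noteq> 0"
        using square_wedge_zero_imp_half by blast
      have "k1 * z - k3 * w = 0 \<and> k2 * z - k1 * w = 0" for z w
        using j[unfolded J, rule_format, of "vector [x, y]" "vector [z, w]"] w by simp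
      from this[of 1 0] this[of 0 1] show "assoc_eqs s" by (simp add: k)
    qed
  next
    assume "assoc_eqs s \<or> half_eqs s"
    then show "law s \<in> jordan_laws"
      unfolding J by (auto simp: k half_imp_square_wedge_zero)
  qed
qed

text \<open>On the plane \<open>half_eqs\<close> the three minors reduce, up to sign, to the product
  and the squares of \<open>q$1\<close> and \<open>q$2\<close>.\<close>

lemma assoc_half_imp_zero:
  assumes "assoc_eqs s" "half_eqs s"
  shows "s = 0"
  using assms by (cases s) (auto simp: vec2_eq zero_prod_def)

subsection \<open>The action\<close>

lemma matrix_inv:
  fixes F :: "real^'n^'n"
  assumes "invertible F"
  shows "F ** matrix_inv F = mat 1" "matrix_inv F ** F = mat 1"
  using someI_ex[OF assms[unfolded invertible_def]] by (simp_all add: matrix_inv_def)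

lemma invertible_matrix_inv:
  fixes F :: "real^'n^'n"
  shows "invertible F \<Longrightarrow> invertible (matrix_inv F)"
  unfolding invertible_def[of "matrix_inv F"] by (metis matrix_inv)

lemma matrix_inv_cancel:
  fixes F :: "real^'n^'n"
  assumes "invertible F"
  shows "matrix_inv F *v (F *v X) = X" "F *v (matrix_inv F *v X) = X"
  using assms by (simp_all add: matrix_vector_mul_assoc matrix_inv)

text \<open>Avoids computing the inverse: it is enough that F intertwines the two laws.\<close>

lemma gl_act_eqI:
  fixes F :: "real^'n^'n"
  assumes "invertible F" "\<And>X Y. \<phi> (F *v X) (F *v Y) = F *v \<psi> X Y"
  shows "gl_act F \<phi> = \<psi>"
  using assms by (simp add: gl_act_def matrix_inv_cancel)

text \<open>The action is a right action, hence the order of the product.\<close>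

lemma gl_act_comp:
  fixes F G :: "real^'n^'n"
  assumes "invertible F" "invertible G"
  shows "gl_act G (gl_act F \<phi>) = gl_act (F ** G) \<phi>"
proof -
  have "gl_act (F ** G) \<phi> = gl_act G (gl_act F \<phi>)"
    by (rule gl_act_eqI)
      (simp_all add: assms invertible_mult gl_act_def matrix_inv_cancel flip: matrix_vector_mul_assoc)
  then show ?thesis ..
qed

lemma gl_act_inv:
  fixes F :: "real^'n^'n"
  assumes "invertible F" "gl_act F \<phi> = \<psi>"
  shows "gl_act (matrix_inv F) \<psi> = \<phi>"
proof (rule gl_act_eqI)
  show "invertible (matrix_inv F)"
    using assms(1) by (rule invertible_matrix_inv)
  show "\<psi> (matrix_inv F *v X) (matrix_inv F *v Y) = matrix_inv F *v \<phi> X Y" for X Y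
    using assms by (auto simp: gl_act_def matrix_inv_cancel)
qed

lemma gl_orbit_refl: "\<phi> \<in> gl_orbit \<phi>"
proof -
  have i: "invertible (mat 1 :: real^'a^'a)" by (simp add: invertible_det_nz)
  have "gl_act (mat 1) \<phi> = \<phi>" by (rule gl_act_eqI[OF i]) simp
  then show ?thesis unfolding gl_orbit_def using i by force
qed

lemma gl_orbit_eq:
  assumes "\<psi> \<in> gl_orbit \<phi>"
  shows "gl_orbit \<psi> = gl_orbit \<phi>"
proof -
  have sub: "gl_orbit \<psi> \<subseteq> gl_orbit \<phi>" if "\<psi> \<in> gl_orbit \<phi>" for \<phi> \<psi> :: "real^'a \<Rightarrow> real^'a \<Rightarrow> real^'a"
    using that unfolding gl_orbit_def by (auto simp: gl_act_comp intro: invertible_mult)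
  have "\<phi> \<in> gl_orbit \<psi>"
    using assms gl_act_inv[OF _ refl, of _ \<phi>] invertible_matrix_inv unfolding gl_orbit_def
    by (smt (verit) mem_Collect_eq)
  then show ?thesis using sub assms by blast
qed

lemma gl_act_jordan:
  assumes "\<phi> \<in> jordan_laws" "invertible F"
  shows "gl_act F \<phi> \<in> jordan_laws"
proof -
  have b: "bilinear \<phi>" and c: "\<phi> X Y = \<phi> Y X" and j: "\<phi> (\<phi> X X) (\<phi> X Y) = \<phi> X (\<phi> (\<phi> X X) Y)" for X Y
    using assms(1) by (auto simp: jordan_laws_def)
  have "bilinear (gl_act F \<phi>)"
    unfolding bilinear_def linear_iff gl_act_def
    by (simp add: matrix_vector_right_distrib matrix_vector_mult_scaleR bilinear_ladd[OF b] bilinear_radd[OF b]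
      bilinear_lmul[OF b] bilinear_rmul[OF b])
  then show ?thesis
    using c j by (simp add: jordan_laws_def gl_act_def matrix_inv_cancel assms(2))
qed

definition basis_matrix :: "real^2 \<Rightarrow> real^2 \<Rightarrow> real^2^2" where
  "basis_matrix u v = (\<chi> i j. if j = 1 then u$i else v$i)"

lemma basis_matrix_mult: "basis_matrix u v *v X = X$1 *\<^sub>R u + X$2 *\<^sub>R v"
  by (simp add: vec2_eq basis_matrix_def matrix_vector_mult_def sum_2)

lemma invertible_basis_matrix: "invertible (basis_matrix u v) \<longleftrightarrow> u$1 * v$2 - u$2 * v$1 \<noteq> 0"
  by (simp add: invertible_det_nz det_2 basis_matrix_def) (auto simp: algebra_simps)

text \<open>A change of basis thus amounts to computing three products and their coordinates in the
  basis u, v.\<close>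

lemma gl_act_basis:
  assumes "bilinear \<phi>" "\<And>X Y. \<phi> X Y = \<phi> Y X"
    and "u$1 * v$2 - u$2 * v$1 \<noteq> 0"
    and "\<phi> u u = p$1 *\<^sub>R u + p$2 *\<^sub>R v" "\<phi> u v = q$1 *\<^sub>R u + q$2 *\<^sub>R v" "\<phi> v v = r$1 *\<^sub>R u + r$2 *\<^sub>R v"
  shows "gl_act (basis_matrix u v) \<phi> = law (p, q, r)"
proof (rule gl_act_eqI)
  show "invertible (basis_matrix u v)"
    using assms(3) by (simp add: invertible_basis_matrix)
  show "\<phi> (basis_matrix u v *v X) (basis_matrix u v *v Y) = basis_matrix u v *v law (p, q, r) X Y" for X Y
    unfolding basis_matrix_mult bilinear_expand2[OF assms(1,2)] assms(4-6)
    by (simp add: law_component algebra_simps)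
qed

subsection \<open>The trace form\<close>

definition trace_form :: "(real^2 \<Rightarrow> real^2 \<Rightarrow> real^2) \<Rightarrow> real^2 \<Rightarrow> real^2 \<Rightarrow> real" where
  "trace_form \<phi> X Y = trace (matrix (\<phi> (\<phi> X Y)))"

text \<open>The Gram determinant of the trace form on the standard basis: multiplication by (z, w)
  has trace z (\<open>p$1 + q$2\<close>) + w (\<open>q$1 + r$2\<close>).\<close>

fun disc :: "R6 \<Rightarrow> real" where
  "disc (p, q, r) =
     (p$1 * (p$1 + q$2) + p$2 * (q$1 + r$2)) * (r$1 * (p$1 + q$2) + r$2 * (q$1 + r$2))
     - (q$1 * (p$1 + q$2) + q$2 * (q$1 + r$2))^2"

lemma trace_form_law:
  "trace_form (law (p, q, r)) X Y =
     (let Z = law (p, q, r) X Y in Z$1 * (p$1 + q$2) + Z$2 * (q$1 + r$2))"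
  by (simp add: trace_form_def trace_def sum_2 matrix_def Let_def)
    (simp add: law_component[of _ "law _ _ _"] axis_def algebra_simps)

text \<open>The Gram determinant of a symmetric bilinear form scales with the square of the
  determinant of the pair X, Y.\<close>

lemma trace_form_gram:
  "trace_form (law s) X X * trace_form (law s) Y Y - (trace_form (law s) X Y)^2
     = (X$1 * Y$2 - X$2 * Y$1)^2 * disc s"
proof -
  obtain p q r where s: "s = (p, q, r)" by (cases s)
  show ?thesis
    unfolding s trace_form_law Let_def law_component fst_conv snd_conv disc.simps by algebra
qed

text \<open>Multiplication operators of the transported law are conjugates by F of the original
  ones, and the trace is invariant under conjugation.\<close>

lemma trace_form_gl_act:
  assumes "bilinear \<phi>" "invertible F"
  shows "trace_form (gl_act F \<phi>) X Y = trace_form \<phi> (F *v X) (F *v Y)"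
proof -
  let ?Z = "\<phi> (F *v X) (F *v Y)"
  have l: "linear (\<phi> ?Z)" using assms(1) by (simp add: bilinear_def)
  have "gl_act F \<phi> (gl_act F \<phi> X Y) = (\<lambda>W. matrix_inv F *v (\<phi> ?Z (F *v W)))"
    by (simp add: gl_act_def matrix_inv_cancel assms)
  also have "\<dots> = (\<lambda>W. (matrix_inv F ** (matrix (\<phi> ?Z) ** F)) *v W)"
    using matrix_vector_mul(2)[OF l, THEN fun_cong] by (simp flip: matrix_vector_mul_assoc)
  finally show ?thesis
    by (simp add: trace_form_def matrix_of_matrix_vector_mul trace_mul_sym[of "matrix_inv F"]
        matrix_inv assms flip: matrix_mul_assoc)
qed

text \<open>The factor k is the square of \<open>det F\<close>, so the sign of \<open>disc\<close>
  is an isomorphism invariant.\<close>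

lemma disc_gl_act:
  assumes "invertible F" "gl_act F (law s) = law s'"
  shows "\<exists>k>0. disc s' = k * disc s"
proof -
  let ?u = "F *v axis 1 1" and ?v = "F *v axis 2 1"
  have *: "trace_form (law s') X Y = trace_form (law s) (F *v X) (F *v Y)" for X Y
    using trace_form_gl_act[OF bilinear_law assms(1), of s X Y] by (simp add: assms(2))
  have "disc s' = (?u$1 * ?v$2 - ?u$2 * ?v$1)^2 * disc s"
    using trace_form_gram[of s' "axis 1 1" "axis 2 1"] trace_form_gram[of s ?u ?v]
    by (simp add: * axis_def)
  moreover have "?u$1 * ?v$2 - ?u$2 * ?v$1 = det F"
    by (simp add: matrix_vector_mult_def sum_2 det_2 axis_def)
  ultimately show ?thesis using assms(1) by (auto simp: invertible_det_nz intro!: exI[of _ "(det F)^2"])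
qed

subsection \<open>Submanifolds\<close>

lemma Ck_on_cong:
  assumes "open U" "\<And>x. x \<in> U \<Longrightarrow> f x = g x" "Ck_on k f U"
  shows "Ck_on k g U"
  using assms(2,3)
proof (induction k arbitrary: f g)
  case 0
  then show ?case using continuous_on_cong[of U U f g] by simp
next
  case (Suc k)
  have d: "(g has_derivative frechet_derivative f (at x)) (at x)" if "x \<in> U" for x
  proof (rule has_derivative_transform_within_open[OF _ assms(1) that])
    show "(f has_derivative frechet_derivative f (at x)) (at x)"
      using Suc.prems(2) that by (simp flip: frechet_derivative_works)
  qed (rule Suc.prems(1))
  then have *: "frechet_derivative f (at x) = frechet_derivative g (at x)" if "x \<in> U" for x
    using that frechet_derivative_at by blast
  then show ?case
    unfolding Ck_on.simps
  proof (intro conjI ballI allI)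
    show "g differentiable at x" if "x \<in> U" for x
      using d[OF that] by (rule differentiableI)
    show "Ck_on k (\<lambda>x. frechet_derivative g (at x) v) U" for v
      by (rule Suc.IH[of "\<lambda>x. frechet_derivative f (at x) v"]) (use Suc.prems(2) * in simp_all)
  qed
qed

text \<open>Allows any explicit derivative in place of \<open>frechet_derivative\<close>; the
  closure properties below use it with the usual differentiation rules.\<close>

lemma Ck_on_SucI:
  assumes "open U" "\<And>x. x \<in> U \<Longrightarrow> (f has_derivative f' x) (at x)"
    and "\<And>v. Ck_on k (\<lambda>x. f' x v) U"
  shows "Ck_on (Suc k) f U"
proof -
  have "f' x = frechet_derivative f (at x)" if "x \<in> U" for x
    using assms(2) that frechet_derivative_at by blast
  then have "Ck_on k (\<lambda>x. frechet_derivative f (at x) v) U" for v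
    by (intro Ck_on_cong[OF assms(1) _ assms(3)[of v]]) auto
  then show ?thesis using assms(2) by (auto simp: differentiable_def)
qed

lemma Ck_on_Suc_deriv:
  "Ck_on (Suc k) f U \<Longrightarrow> x \<in> U \<Longrightarrow> (f has_derivative frechet_derivative f (at x)) (at x)"
  by (simp flip: frechet_derivative_works)

lemma Ck_on_SucD: "Ck_on (Suc k) f U \<Longrightarrow> Ck_on k f U"
proof (induction k arbitrary: f)
  case 0
  then show ?case
    by (auto intro!: continuous_at_imp_continuous_on differentiable_imp_continuous_within)
next
  case (Suc k)
  note * = Suc.prems[unfolded Ck_on.simps(2)[of "Suc k"]]
  show ?case
    unfolding Ck_on.simps(2)[of k] using * Suc.IH by blast
qed

lemma Ck_on_subset: "Ck_on k f U \<Longrightarrow> V \<subseteq> U \<Longrightarrow> Ck_on k f V"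
  by (induction k arbitrary: f) (auto intro: continuous_on_subset)

lemma Ck_on_const: "open U \<Longrightarrow> Ck_on k (\<lambda>x. c) U"
proof (induction k arbitrary: c)
  case (Suc k)
  then show ?case by (intro Ck_on_SucI[where f' = "\<lambda>_ _. 0"]) auto
qed simp

lemma Ck_on_linear:
  assumes "open U" "bounded_linear f"
  shows "Ck_on k f U"
proof (cases k)
  case 0
  then show ?thesis using assms linear_continuous_on by auto
next
  case (Suc n)
  then show ?thesis
    using Ck_on_SucI[OF assms(1) bounded_linear_imp_has_derivative[OF assms(2)], of n]
    by (simp add: Ck_on_const assms(1) del: Ck_on.simps)
qed

lemma Ck_on_add:
  assumes "open U"
  shows "Ck_on k f U \<Longrightarrow> Ck_on k g U \<Longrightarrow> Ck_on k (\<lambda>x. f x + g x) U"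
proof (induction k arbitrary: f g)
  case (Suc k)
  have "Ck_on k (\<lambda>x. frechet_derivative f (at x) v + frechet_derivative g (at x) v) U" for v
    using Suc.prems by (intro Suc.IH) simp_all
  then show ?case
    by (intro Ck_on_SucI[where f' = "\<lambda>x v. frechet_derivative f (at x) v + frechet_derivative g (at x) v"]
      assms has_derivative_add[OF Ck_on_Suc_deriv[OF Suc.prems(1)] Ck_on_Suc_deriv[OF Suc.prems(2)]])
qed (auto intro: continuous_on_add)

lemma Ck_on_scaleR:
  assumes "open U"
  shows "Ck_on k f U \<Longrightarrow> Ck_on k g U \<Longrightarrow> Ck_on k (\<lambda>x. f x *\<^sub>R g x) U"
proof (induction k arbitrary: f g)
  case (Suc k)
  have "Ck_on k (\<lambda>x. f x *\<^sub>R frechet_derivative g (at x) v + frechet_derivative f (at x) v *\<^sub>R g x) U" for v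
    \<comment> \<open>The Leibniz rule also contains f and g undifferentiated, so they are needed at
      the lower order k as well.\<close>
    using Suc.prems Ck_on_SucD[OF Suc.prems(1)] Ck_on_SucD[OF Suc.prems(2)]
    by (intro Ck_on_add[OF assms] Suc.IH) simp_all
  then show ?case
    by (intro Ck_on_SucI[where f' = "\<lambda>x v. f x *\<^sub>R frechet_derivative g (at x) v + frechet_derivative f (at x) v *\<^sub>R g x"]
      assms has_derivative_scaleR[OF Ck_on_Suc_deriv[OF Suc.prems(1)] Ck_on_Suc_deriv[OF Suc.prems(2)]])
qed (auto intro: continuous_on_scaleR)

lemma Ck_on_mult:
  fixes f g :: "'a::euclidean_space \<Rightarrow> real"
  shows "open U \<Longrightarrow> Ck_on k f U \<Longrightarrow> Ck_on k g U \<Longrightarrow> Ck_on k (\<lambda>x. f x * g x) U"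
  using Ck_on_scaleR[of U k f g] by simp

lemma Ck_on_minus:
  assumes "open U" "Ck_on k f U"
  shows "Ck_on k (\<lambda>x. - f x) U"
  using Ck_on_scaleR[OF assms(1) Ck_on_const[OF assms(1), of k "-1"] assms(2)] by simp

lemma Ck_on_diff:
  assumes "open U" "Ck_on k f U" "Ck_on k g U"
  shows "Ck_on k (\<lambda>x. f x - g x) U"
  using Ck_on_add[OF assms(1,2) Ck_on_minus[OF assms(1,3)]] by simp

text \<open>The derivative of 1/f involves only 1/f and the derivative of f, so the induction can
  keep f fixed.\<close>

lemma Ck_on_inverse:
  fixes f :: "'a::euclidean_space \<Rightarrow> real"
  assumes "open U" "\<And>x. x \<in> U \<Longrightarrow> f x \<noteq> 0"
  shows "Ck_on k f U \<Longrightarrow> Ck_on k (\<lambda>x. inverse (f x)) U"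
proof (induction k)
  case (Suc k)
  note f = Ck_on_SucD[OF Suc.prems]
  have "Ck_on k (\<lambda>x. - (inverse (f x) * frechet_derivative f (at x) v * inverse (f x))) U" for v
    using Suc.prems Suc.IH[OF f] by (intro Ck_on_minus Ck_on_mult assms) simp_all
  then show ?case
    by (intro Ck_on_SucI[where f' = "\<lambda>x v. - (inverse (f x) * frechet_derivative f (at x) v * inverse (f x))"]
      assms Deriv.has_derivative_inverse Ck_on_Suc_deriv[OF Suc.prems])
qed (use assms in \<open>auto intro: continuous_on_inverse\<close>)

lemma Ck_on_divide:
  fixes f g :: "'a::euclidean_space \<Rightarrow> real"
  shows "open U \<Longrightarrow> (\<And>x. x \<in> U \<Longrightarrow> g x \<noteq> 0) \<Longrightarrow> Ck_on k f U \<Longrightarrow> Ck_on k g U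
    \<Longrightarrow> Ck_on k (\<lambda>x. f x / g x) U"
  unfolding divide_inverse by (intro Ck_on_mult Ck_on_inverse)

lemma Ck_on_imp_continuous_on: "Ck_on k f U \<Longrightarrow> continuous_on U f"
  by (induction k) (use Ck_on_SucD in \<open>auto simp del: Ck_on.simps(2)\<close>)

section \<open>Slice charts around a point\<close>

definition slice_chart_at :: "nat \<Rightarrow> 'a::euclidean_space set \<Rightarrow> 'a \<Rightarrow> bool" where
  "slice_chart_at d M p \<longleftrightarrow> (\<exists>V W (\<Phi> :: 'a \<Rightarrow> 'a) \<Psi> S.
        open V \<and> p \<in> V \<and> open W \<and> smooth_on \<Phi> V \<and> smooth_on \<Psi> W \<and>
        \<Phi> ` V = W \<and> \<Psi> ` W = V \<and>
        (\<forall>x\<in>V. \<Psi> (\<Phi> x) = x) \<and> (\<forall>y\<in>W. \<Phi> (\<Psi> y) = y) \<and>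
        subspace S \<and> dim S = d \<and> \<Phi> ` (M \<inter> V) = S \<inter> W)"

lemma smooth_submanifold_iff: "smooth_submanifold d M \<longleftrightarrow> (\<forall>p\<in>M. slice_chart_at d M p)"
  by (simp add: smooth_submanifold_def slice_chart_at_def)

text \<open>The chart is restricted to \<open>V \<inter> B\<close>; its image is open because it is
  the preimage of B under the continuous inverse \<Psi>.\<close>

lemma slice_chart_at_Int_open:
  fixes M :: "'a::euclidean_space set"
  assumes "slice_chart_at d M p" "open B" "p \<in> B"
  shows "slice_chart_at d (M \<inter> B) p"
proof -
  obtain V W S and \<Phi> \<Psi> :: "'a \<Rightarrow> 'a" where c: "open V" "p \<in> V" "open W" "smooth_on \<Phi> V" "smooth_on \<Psi> W"
     "\<Phi> ` V = W" "\<Psi> ` W = V" "\<forall>x\<in>V. \<Psi> (\<Phi> x) = x" "\<forall>y\<in>W. \<Phi> (\<Psi> y) = y"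
     "subspace S" "dim S = d" "\<Phi> ` (M \<inter> V) = S \<inter> W"
    using assms(1) unfolding slice_chart_at_def by blast
  let ?V = "V \<inter> B" and ?W = "\<Phi> ` (V \<inter> B)"
  have W: "?W = W \<inter> \<Psi> -` B"
  proof
    show "?W \<subseteq> W \<inter> \<Psi> -` B" using c(6,8) by auto
    show "W \<inter> \<Psi> -` B \<subseteq> ?W" proof
      fix y assume y: "y \<in> W \<inter> \<Psi> -` B"
      then have "\<Psi> y \<in> V \<inter> B" "\<Phi> (\<Psi> y) = y" using c(7,9) by auto
      then show "y \<in> ?W" by (metis imageI)
    qed
  qed
  have "continuous_on W \<Psi>"
    using c(5) Ck_on_imp_continuous_on unfolding smooth_on_def by blast
  then have "open ?W"
    unfolding W using c(3) assms(2) continuous_open_preimage by blast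
  moreover have "smooth_on \<Phi> ?V"
    using c(4) Ck_on_subset unfolding smooth_on_def by blast
  moreover have "smooth_on \<Psi> ?W"
    using c(5) Ck_on_subset unfolding smooth_on_def W by blast
  moreover have "\<Phi> ` (M \<inter> B \<inter> ?V) = S \<inter> ?W"
  proof -
    \<comment> \<open>Injectivity makes the image commute with the intersection.\<close>
    have "inj_on \<Phi> V" using c(8) by (metis inj_onI)
    then have "\<Phi> ` (M \<inter> V) \<inter> ?W = \<Phi> ` ((M \<inter> V) \<inter> (V \<inter> B))"
      by (simp add: inj_on_image_Int)
    also have "(M \<inter> V) \<inter> (V \<inter> B) = M \<inter> B \<inter> ?V" by blast
    finally have "\<Phi> ` (M \<inter> B \<inter> ?V) = \<Phi> ` (M \<inter> V) \<inter> ?W" ..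
    then show ?thesis using c(12) W by auto
  qed
  moreover have "\<Psi> ` ?W = ?V" "\<forall>x\<in>?V. \<Psi> (\<Phi> x) = x" "\<forall>y\<in>?W. \<Phi> (\<Psi> y) = y"
    using c(8) by (force simp: image_image)+
  ultimately show ?thesis
    using c(1,2,10,11) assms(2,3) unfolding slice_chart_at_def
    by (intro exI[of _ ?V] exI[of _ ?W] exI[of _ \<Phi>] exI[of _ \<Psi>] exI[of _ S]) (simp add: open_Int)
qed

lemma smooth_submanifold_Int_open:
  "smooth_submanifold d M \<Longrightarrow> open B \<Longrightarrow> smooth_submanifold d (M \<inter> B)"
  by (simp add: smooth_submanifold_iff slice_chart_at_Int_open)

lemma smooth_submanifold_subspace:
  fixes S :: "'a::euclidean_space set"
  assumes "subspace S" "dim S = d"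
  shows "smooth_submanifold d S"
proof -
  have "smooth_on (\<lambda>x::'a. x) UNIV"
    by (simp add: smooth_on_def Ck_on_linear)
  then show ?thesis
    unfolding smooth_submanifold_iff slice_chart_at_def using assms
    by (intro ballI exI[of _ UNIV] exI[of _ "\<lambda>x::'a. x"] exI[of _ S]) auto
qed

lemma codim2_subspace:
  fixes n1 n2 :: "'a::euclidean_space"
  assumes "n1 \<bullet> n1 = 1" "n2 \<bullet> n2 = 1" "n1 \<bullet> n2 = 0"
  shows "subspace {x. n1 \<bullet> x = 0 \<and> n2 \<bullet> x = 0}" "dim {x. n1 \<bullet> x = 0 \<and> n2 \<bullet> x = 0} = DIM('a) - 2"
proof -
  let ?S = "{x. n1 \<bullet> x = 0 \<and> n2 \<bullet> x = 0}"
  show "subspace ?S" by (auto simp: subspace_def inner_add_right)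
  have "n1 \<noteq> n2" "n1 \<noteq> 0" "n2 \<noteq> 0" using assms by auto
  moreover have "pairwise orthogonal {n1, n2}"
    using assms(3) by (auto simp: pairwise_def orthogonal_def inner_commute)
  ultimately have "dim (span {n1, n2}) = 2"
    using pairwise_orthogonal_independent[of "{n1, n2}"]
    by (simp add: dim_eq_card_independent)
  moreover have "{y \<in> UNIV. \<forall>x\<in>span {n1, n2}. orthogonal x y} = ?S"
  proof (intro set_eqI iffI)
    fix y assume "y \<in> ?S"
    moreover have "subspace {x. x \<bullet> y = 0}" by (rule subspace_hyperplane2)
    ultimately have "span {n1, n2} \<subseteq> {x. x \<bullet> y = 0}"
      by (intro span_minimal) auto
    then show "y \<in> {y \<in> UNIV. \<forall>x\<in>span {n1, n2}. orthogonal x y}"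
      by (auto simp: orthogonal_def)
  qed (simp add: orthogonal_def span_base)
  ultimately show "dim ?S = DIM('a) - 2"
    using dim_subspace_orthogonal_to_vectors[of "span {n1, n2}" UNIV] by simp
qed

text \<open>Here \<open>M\<close> is locally the graph of \<open>(g1, g2)\<close> over the orthogonal complement of \<open>n1, n2\<close>
  along the directions \<open>w1, w2\<close>.\<close>

lemma slice_chart_at_graph2:
  fixes M :: "'a::euclidean_space set" and g1 g2 :: "'a \<Rightarrow> real"
  assumes "open V"
    and g: "\<And>k. Ck_on k g1 V" "\<And>k. Ck_on k g2 V"
    and V: "\<And>x s t. x \<in> V \<Longrightarrow> x + s *\<^sub>R w1 + t *\<^sub>R w2 \<in> V"
    and g1: "\<And>x s t. x \<in> V \<Longrightarrow> g1 (x + s *\<^sub>R w1 + t *\<^sub>R w2) = g1 x"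
    and g2: "\<And>x s t. x \<in> V \<Longrightarrow> g2 (x + s *\<^sub>R w1 + t *\<^sub>R w2) = g2 x"
    and n: "n1 \<bullet> n1 = 1" "n2 \<bullet> n2 = 1" "n1 \<bullet> n2 = 0"
    and w: "n1 \<bullet> w1 = 1" "n1 \<bullet> w2 = 0" "n2 \<bullet> w1 = 0" "n2 \<bullet> w2 = 1"
    and M: "\<And>x. x \<in> V \<Longrightarrow> x \<in> M \<longleftrightarrow> n1 \<bullet> x = g1 x \<and> n2 \<bullet> x = g2 x"
    and p: "p \<in> V"
  shows "slice_chart_at (DIM('a) - 2) M p"
proof -
  \<comment> \<open>Two shears along \<open>w1\<close> and \<open>w2\<close>. They are mutually
    inverse since \<open>g1\<close> and \<open>g2\<close> are constant along these directions, and
    the first one flattens the graph to the subspace orthogonal to \<open>n1\<close> and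
    \<open>n2\<close>.\<close>
  let ?\<Phi> = "\<lambda>x. x + (- g1 x) *\<^sub>R w1 + (- g2 x) *\<^sub>R w2"
  let ?\<Psi> = "\<lambda>x. x + g1 x *\<^sub>R w1 + g2 x *\<^sub>R w2"
  let ?S = "{x. n1 \<bullet> x = 0 \<and> n2 \<bullet> x = 0}"
  have "smooth_on ?\<Phi> V" "smooth_on ?\<Psi> V"
    unfolding smooth_on_def
    by (intro allI Ck_on_add Ck_on_scaleR Ck_on_minus g Ck_on_const Ck_on_linear bounded_linear_ident \<open>open V\<close>)+
  moreover have inv: "?\<Psi> (?\<Phi> x) = x" "?\<Phi> (?\<Psi> x) = x" if "x \<in> V" for x
    using that by (simp_all add: g1 g2 del: scaleR_minus_left) simp_all
  moreover have im: "?\<Phi> ` V = V" "?\<Psi> ` V = V"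
  proof -
    have "?\<Phi> x \<in> V" "?\<Psi> x \<in> V" if "x \<in> V" for x
      using V[OF that] by blast+
    then show "?\<Phi> ` V = V" "?\<Psi> ` V = V"
      using inv by (force simp del: scaleR_minus_left intro: image_eqI[OF sym])+
  qed
  moreover have "?\<Phi> ` (M \<inter> V) = ?S \<inter> V"
  proof
    show "?\<Phi> ` (M \<inter> V) \<subseteq> ?S \<inter> V"
      using M V w by (auto simp: inner_add_right simp del: scaleR_minus_left)
    show "?S \<inter> V \<subseteq> ?\<Phi> ` (M \<inter> V)"
    proof
      fix y assume y: "y \<in> ?S \<inter> V"
      then have "?\<Psi> y \<in> M \<inter> V"
        using V M by (simp add: inner_add_right w g1 g2)
      then show "y \<in> ?\<Phi> ` (M \<inter> V)"
        using inv(2)[of y] y by (intro image_eqI[where x = "?\<Psi> y"]) simp_all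
    qed
  qed
  ultimately show ?thesis
    unfolding slice_chart_at_def using p \<open>open V\<close> codim2_subspace[OF n]
    by (intro exI[of _ V] exI[of _ ?\<Phi>] exI[of _ ?\<Psi>] exI[of _ ?S]) (simp del: scaleR_minus_left)
qed

subsection \<open>Normal forms and orbits\<close>

definition vec2 :: "real \<Rightarrow> real \<Rightarrow> real^2" where
  "vec2 x y = x *\<^sub>R axis 1 1 + y *\<^sub>R axis 2 1"

lemma vec2_nth [simp]: "vec2 x y $ 1 = x" "vec2 x y $ 2 = y"
  by (simp_all add: vec2_def axis_def)

lemma vec2_0 [simp]: "vec2 0 0 = 0" by (simp add: vec2_def)

lemma tendsto_vec2 [tendsto_intros]:
  "(f \<longlongrightarrow> a) F \<Longrightarrow> (g \<longlongrightarrow> b) F \<Longrightarrow> ((\<lambda>t. vec2 (f t) (g t)) \<longlongrightarrow> vec2 a b) F"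
  unfolding vec2_def by (intro tendsto_intros)

lemma continuous_on_vec2 [continuous_intros]:
  "continuous_on S f \<Longrightarrow> continuous_on S g \<Longrightarrow> continuous_on S (\<lambda>t. vec2 (f t) (g t))"
  unfolding vec2_def by (intro continuous_intros)

lemma continuous_on_basis_matrix [continuous_intros]:
  assumes "continuous_on S u" "continuous_on S v"
  shows "continuous_on S (\<lambda>t. basis_matrix (u t) (v t))"
proof -
  have "continuous_on S (\<lambda>t. if j = 1 then u t $ i else v t $ i)" for i j :: 2
    using assms by (cases "j = 1") (auto intro: continuous_intros)
  then show ?thesis unfolding basis_matrix_def by (intro continuous_on_vec_lambda)
qed

text \<open>The three rigid models: \<real> x \<real> in the basis of its idempotents, \<complex> in
  the basis 1, i, and the law XY = (l(X) Y + l(Y) X) / 2 where l is the first coordinate.\<close>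

definition split_sc :: R6 where "split_sc = (vec2 1 0, 0, vec2 0 1)"
definition complex_sc :: R6 where "complex_sc = (vec2 1 0, vec2 0 1, vec2 (-1) 0)"
definition half_sc :: R6 where "half_sc = (vec2 1 0, vec2 0 (1/2), 0)"

text \<open>The algebra \<open>x \<real>[x] / (x\<^sup>3 - m x\<^sup>2 - n x)\<close> in the basis \<open>x, x\<^sup>2\<close>.\<close>

definition power_sc :: "real \<Rightarrow> real \<Rightarrow> R6" where
  "power_sc m n = (vec2 0 1, vec2 n m, vec2 (m * n) (m^2 + n))"

text \<open>This is the discriminant of the cubic x^3 - m x^2 - n x: if its roots are 0, \<alpha>,
  \<beta>, it equals (\<alpha> \<beta>)^2 (\<alpha> - \<beta>)^2.\<close>

lemma disc_power_sc: "disc (power_sc m n) = n^2 * (m^2 + 4 * n)"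
  unfolding power_sc_def disc.simps vec2_nth by algebra

text \<open>The element (\<alpha>, \<beta>) of \<real> x \<real> is a root of x (x - \<alpha>) (x -
  \<beta>). Together with its square it forms a basis, by a Vandermonde determinant.\<close>

lemma gl_act_split_power:
  assumes "\<alpha> \<noteq> 0" "\<beta> \<noteq> 0" "\<alpha> \<noteq> \<beta>"
  shows "gl_act (basis_matrix (vec2 \<alpha> \<beta>) (vec2 (\<alpha>^2) (\<beta>^2))) (law split_sc) = law (power_sc (\<alpha> + \<beta>) (- (\<alpha> * \<beta>)))"
  unfolding power_sc_def
proof (rule gl_act_basis[OF bilinear_law law_commute])
  have "\<alpha> * \<beta>^2 - \<beta> * \<alpha>^2 = \<alpha> * \<beta> * (\<beta> - \<alpha>)" by algebra
  then show "vec2 \<alpha> \<beta> $ 1 * vec2 (\<alpha>^2) (\<beta>^2) $ 2 - vec2 \<alpha> \<beta> $ 2 * vec2 (\<alpha>^2) (\<beta>^2) $ 1 \<noteq> 0"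
    using assms by simp
qed (simp_all add: vec2_eq law_component split_sc_def power2_eq_square algebra_simps)

text \<open>The generator is p + q i, a root of x^2 - 2 p x + (p^2 + q^2).\<close>

lemma gl_act_complex_power:
  assumes "q \<noteq> 0"
  shows "gl_act (basis_matrix (vec2 p q) (vec2 (p^2 - q^2) (2 * p * q))) (law complex_sc)
     = law (power_sc (2 * p) (- (p^2 + q^2)))"
  unfolding power_sc_def
proof (rule gl_act_basis[OF bilinear_law law_commute])
  have "p * (2 * p * q) - q * (p^2 - q^2) = q * (p^2 + q^2)" by algebra
  then show "vec2 p q $ 1 * vec2 (p^2 - q^2) (2 * p * q) $ 2 - vec2 p q $ 2 * vec2 (p^2 - q^2) (2 * p * q) $ 1 \<noteq> 0"
    using assms by (simp add: sum_power2_eq_zero_iff)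
qed (simp_all add: vec2_eq law_component complex_sc_def power2_eq_square algebra_simps)

text \<open>A nonzero associative law does not satisfy \<open>half_eqs\<close>, so some X is
  linearly independent of its square. In the basis X, X^2 associativity determines X^2 X^2 from
  X^3.\<close>

lemma assoc_normal_form:
  assumes "assoc_eqs s" "s \<noteq> 0"
  obtains F m n where "invertible F" "gl_act F (law s) = law (power_sc m n)"
proof -
  have "\<not> half_eqs s" using assoc_half_imp_zero assms by blast
  then obtain x y where w: "square_wedge s x y \<noteq> 0"
    using square_wedge_zero_imp_half by blast
  define X where "X = vec2 x y"
  define X2 where "X2 = law s X X"
  define D where "D = X$1 * X2$2 - X$2 * X2$1"
  have D: "D \<noteq> 0" using w square_wedge_law[of s X] by (simp add: X_def X2_def D_def)
  define Y where "Y = law s X X2"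
  \<comment> \<open>Cramer's rule for the coordinates of X^3 in the basis X, X^2.\<close>
  define n m where "n = (Y$1 * X2$2 - Y$2 * X2$1) / D" and "m = (X$1 * Y$2 - X$2 * Y$1) / D"
  have Y: "Y = n *\<^sub>R X + m *\<^sub>R X2"
    using D unfolding vec2_eq n_def m_def by (simp add: field_simps) (simp add: D_def algebra_simps)
  have "law s X2 X2 = law s X (law s X X2)"
    unfolding X2_def by (rule law_assoc[OF assms(1)])
  also have "\<dots> = n *\<^sub>R X2 + m *\<^sub>R Y"
    unfolding Y_def[symmetric]
    by (simp add: Y bilinear_radd[OF bilinear_law] bilinear_rmul[OF bilinear_law] flip: X2_def)
      (simp flip: Y_def Y)
  finally have "law s X2 X2 = (m * n) *\<^sub>R X + (m^2 + n) *\<^sub>R X2"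
    by (simp add: Y algebra_simps power2_eq_square)
  then have "gl_act (basis_matrix X X2) (law s) = law (power_sc m n)"
    unfolding power_sc_def using D Y
    by (intro gl_act_basis bilinear_law law_commute) (simp_all add: D_def Y_def X2_def)
  then show thesis using that D invertible_basis_matrix D_def by metis
qed

lemma gl_orbit_jordanD:
  assumes "\<phi> \<in> gl_orbit (law s)" "law s \<in> jordan_laws"
  obtains F t where "invertible F" "\<phi> = law t" "gl_act F (law s) = law t" "law t \<in> jordan_laws"
proof -
  obtain F where F: "invertible F" "\<phi> = gl_act F (law s)"
    using assms(1) by (auto simp: gl_orbit_def)
  have "\<phi> \<in> jordan_laws" using F assms(2) by (simp add: gl_act_jordan)
  then show thesis using that[of F "structure_constants \<phi>"] F jordan_law_structure_constants by metis
qed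

lemma gl_orbitI: "invertible F \<Longrightarrow> gl_act F \<phi> = \<psi> \<Longrightarrow> \<psi> \<in> gl_orbit \<phi>"
  by (auto simp: gl_orbit_def)

lemma gl_orbitI': "invertible F \<Longrightarrow> gl_act F \<phi> = \<psi> \<Longrightarrow> \<phi> \<in> gl_orbit \<psi>"
  using gl_act_inv invertible_matrix_inv gl_orbitI by blast

text \<open>If X^2 = l(X) X, the trace form is 3/2 l(X) l(Y), of rank at most one.\<close>

lemma half_disc: "half_eqs s \<Longrightarrow> disc s = 0"
  by (cases s) (auto simp: algebra_simps power2_eq_square)

lemma split_jordan: "law split_sc \<in> jordan_laws"
  and complex_jordan: "law complex_sc \<in> jordan_laws"
  and half_jordan: "law half_sc \<in> jordan_laws"
  by (auto simp: jordan_law_iff split_sc_def complex_sc_def half_sc_def)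

lemma jordan_disc_nonzero:
  assumes "law s \<in> jordan_laws" "disc s \<noteq> 0"
  shows "assoc_eqs s" "s \<noteq> 0"
proof -
  show "assoc_eqs s" using assms half_disc jordan_law_iff by blast
  have "disc 0 = 0" by (simp add: zero_prod_def)
  then show "s \<noteq> 0" using assms(2) by auto
qed

section \<open>The three orbits in terms of invariants\<close>

lemma gl_orbit_split: "gl_orbit (law split_sc) = law ` {s. law s \<in> jordan_laws \<and> disc s > 0}"
proof
  show "gl_orbit (law split_sc) \<subseteq> law ` {s. law s \<in> jordan_laws \<and> disc s > 0}"
  proof
    fix \<phi> assume "\<phi> \<in> gl_orbit (law split_sc)"
    then obtain F t where t: "invertible F" "\<phi> = law t" "gl_act F (law split_sc) = law t" "law t \<in> jordan_laws"
      using split_jordan by (rule gl_orbit_jordanD)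
    have "disc split_sc = 1" by (simp add: split_sc_def)
    then have "disc t > 0" using disc_gl_act[OF t(1,3)] by auto
    then show "\<phi> \<in> law ` {s. law s \<in> jordan_laws \<and> disc s > 0}" using t by blast
  qed
  show "law ` {s. law s \<in> jordan_laws \<and> disc s > 0} \<subseteq> gl_orbit (law split_sc)"
  proof clarify
    fix s assume s: "law s \<in> jordan_laws" "disc s > 0"
    obtain F m n where F: "invertible F" "gl_act F (law s) = law (power_sc m n)"
      using jordan_disc_nonzero[of s] s by (metis assoc_normal_form less_irrefl)
    have "n^2 * (m^2 + 4 * n) > 0"
      using disc_gl_act[OF F] s(2) disc_power_sc by force
    then have n: "n \<noteq> 0" and d: "m^2 + 4 * n > 0" by (auto simp: zero_less_mult_iff)
    \<comment> \<open>The two distinct real roots of x^2 - m x - n; they are nonzero because n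
      is.\<close>
    define \<alpha> \<beta> where "\<alpha> = (m + sqrt (m^2 + 4 * n)) / 2" and "\<beta> = (m - sqrt (m^2 + 4 * n)) / 2"
    have ab: "\<alpha> + \<beta> = m" by (simp add: \<alpha>_def \<beta>_def field_simps)
    have "\<alpha> * \<beta> = (m^2 - (sqrt (m^2 + 4 * n))^2) / 4"
      unfolding \<alpha>_def \<beta>_def by (simp add: field_simps power2_eq_square)
    then have "- (\<alpha> * \<beta>) = n" using d by simp
    moreover have "\<alpha> \<noteq> \<beta>" using d by (simp add: \<alpha>_def \<beta>_def)
    ultimately have "law (power_sc m n) \<in> gl_orbit (law split_sc)"
      using gl_act_split_power[of \<alpha> \<beta>] n ab
      by (intro gl_orbitI[of "basis_matrix (vec2 \<alpha> \<beta>) (vec2 (\<alpha>^2) (\<beta>^2))"])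
        (auto simp: invertible_basis_matrix power2_eq_square)
    then show "law s \<in> gl_orbit (law split_sc)"
      using gl_orbitI'[OF F] gl_orbit_eq by blast
  qed
qed

lemma gl_orbit_complex: "gl_orbit (law complex_sc) = law ` {s. law s \<in> jordan_laws \<and> disc s < 0}"
proof
  show "gl_orbit (law complex_sc) \<subseteq> law ` {s. law s \<in> jordan_laws \<and> disc s < 0}"
  proof
    fix \<phi> assume "\<phi> \<in> gl_orbit (law complex_sc)"
    then obtain F t where t: "invertible F" "\<phi> = law t" "gl_act F (law complex_sc) = law t" "law t \<in> jordan_laws"
      using complex_jordan by (rule gl_orbit_jordanD)
    have "disc complex_sc = - 4" by (simp add: complex_sc_def)
    then have "disc t < 0" using disc_gl_act[OF t(1,3)] by auto
    then show "\<phi> \<in> law ` {s. law s \<in> jordan_laws \<and> disc s < 0}" using t by blast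
  qed
  show "law ` {s. law s \<in> jordan_laws \<and> disc s < 0} \<subseteq> gl_orbit (law complex_sc)"
  proof clarify
    fix s assume s: "law s \<in> jordan_laws" "disc s < 0"
    obtain F m n where F: "invertible F" "gl_act F (law s) = law (power_sc m n)"
      using jordan_disc_nonzero[of s] s by (metis assoc_normal_form less_irrefl)
    have "n^2 * (m^2 + 4 * n) < 0"
      using disc_gl_act[OF F] s(2) disc_power_sc by (metis mult_pos_neg)
    then have d: "m^2 + 4 * n < 0" by (auto simp: mult_less_0_iff)
    \<comment> \<open>The roots of x^2 - m x - n are p + q i and p - q i.\<close>
    define p q where "p = m / 2" and "q = sqrt (- (m^2 + 4 * n)) / 2"
    have q: "q \<noteq> 0" using d by (simp add: q_def)
    have "q^2 = - (m^2 + 4 * n) / 4" using d by (simp add: q_def power_divide)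
    then have n: "- (p^2 + q^2) = n" by (simp add: p_def power_divide field_simps)
    have "law (power_sc m n) \<in> gl_orbit (law complex_sc)"
    proof (rule gl_orbitI)
      have "p * (2 * p * q) - q * (p^2 - q^2) = q * (p^2 + q^2)" by algebra
      then show "invertible (basis_matrix (vec2 p q) (vec2 (p^2 - q^2) (2 * p * q)))"
        using q by (simp add: invertible_basis_matrix sum_power2_eq_zero_iff)
      show "gl_act (basis_matrix (vec2 p q) (vec2 (p^2 - q^2) (2 * p * q))) (law complex_sc) = law (power_sc m n)"
        using gl_act_complex_power[OF q, of p] n by (simp add: p_def)
    qed
    then show "law s \<in> gl_orbit (law complex_sc)"
      using gl_orbitI'[OF F] gl_orbit_eq by blast
  qed
qed

text \<open>A coordinate-free form of \<open>half_eqs\<close>, from which its invariance under the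
  action is visible.\<close>

lemma half_eqs_iff: "half_eqs s \<longleftrightarrow> (\<forall>X. \<exists>k. law s X X = k *\<^sub>R X)"
proof
  assume h: "half_eqs s"
  obtain p q r where s: "s = (p, q, r)" by (cases s)
  have "law s X X = (p$1 * X$1 + r$2 * X$2) *\<^sub>R X" for X
    using h by (simp add: s vec2_eq law_component algebra_simps)
  then show "\<forall>X. \<exists>k. law s X X = k *\<^sub>R X" by blast
next
  assume *: "\<forall>X. \<exists>k. law s X X = k *\<^sub>R X"
  have "square_wedge s x y = 0" for x y
  proof -
    obtain k where "law s (vec2 x y) (vec2 x y) = k *\<^sub>R vec2 x y" using * by blast
    then show ?thesis using square_wedge_law[of s "vec2 x y"] by simp
  qed
  then show "half_eqs s" by (rule square_wedge_zero_imp_half)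
qed

lemma gl_act_zero: "gl_act F (law 0) = law 0"
  by (simp add: gl_act_def law_def fun_eq_iff)

lemma gl_orbit_half: "gl_orbit (law half_sc) = law ` {s. law s \<in> jordan_laws \<and> \<not> assoc_eqs s}"
proof
  show "gl_orbit (law half_sc) \<subseteq> law ` {s. law s \<in> jordan_laws \<and> \<not> assoc_eqs s}"
  proof
    fix \<phi> assume "\<phi> \<in> gl_orbit (law half_sc)"
    then obtain F t where t: "invertible F" "\<phi> = law t" "gl_act F (law half_sc) = law t" "law t \<in> jordan_laws"
      using half_jordan by (rule gl_orbit_jordanD)
    have h: "half_eqs half_sc" by (simp add: half_sc_def)
    have "\<exists>k. law t X X = k *\<^sub>R X" for X
    proof -
      obtain k where "law half_sc (F *v X) (F *v X) = k *\<^sub>R (F *v X)"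
        using h half_eqs_iff by blast
      then have "law t X X = k *\<^sub>R X"
        unfolding t(3)[symmetric] gl_act_def
        by (simp add: matrix_vector_mult_scaleR matrix_inv_cancel[OF t(1)])
      then show ?thesis ..
    qed
    then have "half_eqs t" by (simp add: half_eqs_iff)
    \<comment> \<open>The zero law also satisfies \<open>half_eqs\<close>, but it is fixed by the
      action and so lies in an orbit of its own.\<close>
    moreover have "t \<noteq> 0"
    proof
      assume "t = 0"
      then have "law half_sc = law 0" using gl_act_inv[OF t(1,3)] by (simp add: gl_act_zero)
      then have "half_sc = 0" by (metis structure_constants_law)
      then show False by (simp add: half_sc_def zero_prod_def vec2_eq)
    qed
    ultimately show "\<phi> \<in> law ` {s. law s \<in> jordan_laws \<and> \<not> assoc_eqs s}"
      using t assoc_half_imp_zero by blast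
  qed
  show "law ` {s. law s \<in> jordan_laws \<and> \<not> assoc_eqs s} \<subseteq> gl_orbit (law half_sc)"
  proof clarify
    fix s assume s: "law s \<in> jordan_laws" "\<not> assoc_eqs s"
    then have h: "half_eqs s" by (simp add: jordan_law_iff)
    obtain p q r where pqr: "s = (p, q, r)" by (cases s)
    define a b N where "a = p$1" and "b = r$2" and "N = a^2 + b^2"
    have s': "s = (vec2 a 0, vec2 (b/2) (a/2), vec2 0 b)"
      using h by (simp add: pqr vec2_eq a_def b_def)
    have N: "N \<noteq> 0"
      using s(2) unfolding N_def s' by (auto simp: sum_power2_eq_zero_iff)
    \<comment> \<open>With l(x, y) = a x + b y, the first vector is normalised to l(u) = 1 and the
      second spans the kernel of l.\<close>
    let ?u = "vec2 (a/N) (b/N)" and ?v = "vec2 (- b) a"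
    have 1: "a * a / N + b * b / N = 1"
      using N by (simp add: N_def power2_eq_square flip: add_divide_distrib)
    have "gl_act (basis_matrix ?u ?v) (law s) = law half_sc"
      unfolding half_sc_def
    proof (rule gl_act_basis[OF bilinear_law law_commute])
      show "?u $ 1 * ?v $ 2 - ?u $ 2 * ?v $ 1 \<noteq> 0" using 1 by simp
      have "law s ?u ?u = (a * a / N + b * b / N) *\<^sub>R ?u"
        by (simp add: vec2_eq law_component s' algebra_simps)
      then show "law s ?u ?u = vec2 1 0 $ 1 *\<^sub>R ?u + vec2 1 0 $ 2 *\<^sub>R ?v" by (simp add: 1)
      have "law s ?u ?v = ((a * a / N + b * b / N) / 2) *\<^sub>R ?v"
        by (simp add: vec2_eq law_component s' field_simps)
      then show "law s ?u ?v = vec2 0 (1/2) $ 1 *\<^sub>R ?u + vec2 0 (1/2) $ 2 *\<^sub>R ?v" by (simp add: 1)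
      show "law s ?v ?v = 0 $ 1 *\<^sub>R ?u + 0 $ 2 *\<^sub>R ?v"
        by (simp add: vec2_eq law_component s' algebra_simps)
    qed
    then show "law s \<in> gl_orbit (law half_sc)"
      by (rule gl_orbitI'[rotated]) (use 1 in \<open>simp add: invertible_basis_matrix\<close>)
  qed
qed

subsection \<open>Open orbits\<close>

lemma openin_jordan2:
  assumes "open U"
  shows "openin jordan2_topology (law ` {s. law s \<in> jordan_laws \<and> s \<in> U})"
proof -
  have "law ` {s. law s \<in> jordan_laws \<and> s \<in> U} = structure_constants -` U \<inter> jordan_laws"
    using jordan_law_structure_constants by (force simp: image_iff)
  then show ?thesis
    unfolding jordan2_topology_def openin_pullback_topology using assms by auto
qed

lemma disc_continuous: "continuous_on UNIV disc"
proof -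
  have "continuous_on UNIV (\<lambda>s. disc (fst s, fst (snd s), snd (snd s)))"
    unfolding disc.simps by (intro continuous_intros)
  then show ?thesis by simp
qed

lemma open_disc_pos: "open {s. disc s > 0}"
  and open_disc_neg: "open {s. disc s < 0}"
  by (intro open_Collect_less disc_continuous continuous_on_const)+

lemma open_nonassoc: "open {s. \<not> assoc_eqs s}"
proof -
  have "closed {s. assoc_eqs (fst s, fst (snd s), snd (snd s))}"
    unfolding assoc_eqs.simps by (intro closed_Collect_conj closed_Collect_eq continuous_intros)
  then show ?thesis by (simp add: closed_def Collect_neg_eq)
qed

lemma open_orbit_split: "openin jordan2_topology (gl_orbit (law split_sc))"
  and open_orbit_complex: "openin jordan2_topology (gl_orbit (law complex_sc))"
  and open_orbit_half: "openin jordan2_topology (gl_orbit (law half_sc))"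
  unfolding gl_orbit_split gl_orbit_complex gl_orbit_half
  using openin_jordan2[OF open_disc_pos] openin_jordan2[OF open_disc_neg] openin_jordan2[OF open_nonassoc]
  by simp_all

subsection \<open>Contractions\<close>

text \<open>For small t the transported law is already in the open set. Applied to an orbit A, this
  shows that an open orbit containing a contraction of \<phi> also meets the orbit of
  \<phi>.\<close>

lemma contraction_meets_open:
  assumes "is_contraction \<phi>' \<phi>" "\<phi>' \<in> A" "openin jordan2_topology A"
  obtains F where "invertible F" "gl_act F \<phi> \<in> A"
proof -
  obtain U where U: "open U" "A = structure_constants -` U \<inter> jordan_laws"
    using assms(3) by (auto simp: jordan2_topology_def openin_pullback_topology)
  obtain f :: "real \<Rightarrow> real^2^2" where f: "\<phi> \<in> jordan_laws" "\<forall>t>0. invertible (f t)"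
    "\<And>X Y. ((\<lambda>t. gl_act (f t) \<phi> X Y) \<longlongrightarrow> \<phi>' X Y) (at_right 0)"
    using assms(1) unfolding is_contraction_def by blast
  have "((\<lambda>t. structure_constants (gl_act (f t) \<phi>)) \<longlongrightarrow> structure_constants \<phi>') (at_right 0)"
    unfolding structure_constants_def by (intro tendsto_Pair f(3))
  then have "eventually (\<lambda>t. structure_constants (gl_act (f t) \<phi>) \<in> U) (at_right 0)"
    using U assms(2) by (auto dest: topological_tendstoD)
  moreover have "eventually (\<lambda>t. t > 0) (at_right (0::real))"
    by (rule eventually_at_right_less)
  ultimately have "eventually (\<lambda>t. t > 0 \<and> structure_constants (gl_act (f t) \<phi>) \<in> U) (at_right 0)"
    by eventually_elim simp
  then obtain t where "t > 0" "structure_constants (gl_act (f t) \<phi>) \<in> U"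
    using eventually_happens' trivial_limit_at_right_real by blast
  then show thesis
    using that[of "f t"] f(1,2) U(2) by (simp add: gl_act_jordan)
qed

text \<open>Composing every member of the family with G moves the limit within its isomorphism
  class, so it is enough to treat normal forms.\<close>

lemma is_contraction_gl_act:
  assumes "is_contraction \<phi>' \<phi>" "invertible G"
  shows "is_contraction (gl_act G \<phi>') \<phi>"
proof -
  obtain f where f: "\<phi> \<in> jordan_laws" "continuous_on {0<..} f" "\<forall>t>0::real. invertible (f t)"
    "\<And>X Y. ((\<lambda>t. gl_act (f t) \<phi> X Y) \<longlongrightarrow> \<phi>' X Y) (at_right 0)"
    using assms(1) unfolding is_contraction_def by blast
  have "((\<lambda>t. gl_act (f t ** G) \<phi> X Y) \<longlongrightarrow> gl_act G \<phi>' X Y) (at_right 0)" for X Y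
  proof (rule Lim_transform_eventually)
    show "((\<lambda>t. gl_act G (gl_act (f t) \<phi>) X Y) \<longlongrightarrow> gl_act G \<phi>' X Y) (at_right 0)"
      unfolding gl_act_def[of G]
      by (rule bounded_linear.tendsto[OF matrix_vector_mul_bounded_linear f(4)])
    show "\<forall>\<^sub>F t in at_right 0. gl_act G (gl_act (f t) \<phi>) X Y = gl_act (f t ** G) \<phi> X Y"
      using eventually_at_right_less[of "0::real"]
      by eventually_elim (simp add: gl_act_comp f(3) assms(2))
  qed
  moreover have "continuous_on {0<..} (\<lambda>t. f t ** G)"
    unfolding matrix_matrix_mult_def
    by (intro continuous_on_vec_lambda continuous_intros f(2))
  ultimately show ?thesis
    unfolding is_contraction_def using f assms(2)
    by (intro conjI exI[of _ "\<lambda>t. f t ** G"]) (auto intro: invertible_mult)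
qed

lemma is_contraction_lawI:
  fixes F :: "real \<Rightarrow> real^2^2"
  assumes "\<phi> \<in> jordan_laws" "continuous_on {0<..} F" "\<And>t. t > 0 \<Longrightarrow> invertible (F t)"
    and "\<And>t. t > 0 \<Longrightarrow> gl_act (F t) \<phi> = law (s t)"
    and "(s \<longlongrightarrow> s') (at_right 0)"
  shows "is_contraction (law s') \<phi>"
  unfolding is_contraction_def
proof (intro conjI exI[of _ F] allI impI assms)
  fix X Y
  show "((\<lambda>t. gl_act (F t) \<phi> X Y) \<longlongrightarrow> law s' X Y) (at_right 0)"
  proof (rule Lim_transform_eventually)
    show "((\<lambda>t. law (s t) X Y) \<longlongrightarrow> law s' X Y) (at_right 0)"
      unfolding law_def by (intro tendsto_intros assms(5))
    show "\<forall>\<^sub>F t in at_right 0. law (s t) X Y = gl_act (F t) \<phi> X Y"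
      using eventually_at_right_less[of "0::real"] by eventually_elim (simp add: assms(4))
  qed
qed

text \<open>Here \<alpha> and \<beta> are the nonzero roots of the cubic. They are distinct and
  nonzero for positive t, but in the limit they may coincide or vanish.\<close>

lemma is_contraction_power:
  fixes \<alpha> \<beta> :: "real \<Rightarrow> real"
  assumes "continuous_on {0<..} \<alpha>" "continuous_on {0<..} \<beta>"
    and "\<And>t. t > 0 \<Longrightarrow> \<alpha> t \<noteq> 0 \<and> \<beta> t \<noteq> 0 \<and> \<alpha> t \<noteq> \<beta> t"
    and "(\<alpha> \<longlongrightarrow> a) (at_right 0)" "(\<beta> \<longlongrightarrow> b) (at_right 0)"
  shows "is_contraction (law (power_sc (a + b) (- (a * b)))) (law split_sc)"
proof (rule is_contraction_lawI[OF split_jordan])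
  let ?F = "\<lambda>t. basis_matrix (vec2 (\<alpha> t) (\<beta> t)) (vec2 ((\<alpha> t)^2) ((\<beta> t)^2))"
  show "continuous_on {0<..} ?F" by (intro continuous_intros assms)
  show "invertible (?F t)" if "t > 0" for t
    using assms(3)[OF that] by (auto simp: invertible_basis_matrix power2_eq_square)
  show "gl_act (?F t) (law split_sc) = law (power_sc (\<alpha> t + \<beta> t) (- (\<alpha> t * \<beta> t)))" if "t > 0" for t
    using assms(3)[OF that] by (simp add: gl_act_split_power)
  show "((\<lambda>t. power_sc (\<alpha> t + \<beta> t) (- (\<alpha> t * \<beta> t))) \<longlongrightarrow> power_sc (a + b) (- (a * b))) (at_right 0)"
    unfolding power_sc_def by (intro tendsto_intros assms)
qed

text \<open>Scaling the basis by t scales all structure constants by t.\<close>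

lemma is_contraction_zero: "is_contraction (law 0) (law split_sc)"
proof (rule is_contraction_lawI[OF split_jordan])
  let ?F = "\<lambda>t. basis_matrix (vec2 t 0) (vec2 0 t)"
  show "continuous_on {0<..} ?F" by (intro continuous_intros)
  show "invertible (?F t)" if "t > 0" for t
    using that by (simp add: invertible_basis_matrix)
  show "gl_act (?F t) (law split_sc) = law (vec2 t 0, 0, vec2 0 t)" if "t > 0" for t
    by (rule gl_act_basis[OF bilinear_law law_commute])
      (use that in \<open>simp_all add: vec2_eq law_component split_sc_def\<close>)
  have "((\<lambda>t. (vec2 t 0, 0 :: real^2, vec2 0 t)) \<longlongrightarrow> (vec2 0 0, 0, vec2 0 0)) (at_right 0)"
    by (intro tendsto_intros)
  then show "((\<lambda>t. (vec2 t 0, 0, vec2 0 t)) \<longlongrightarrow> (0 :: R6)) (at_right 0)"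
    by (simp add: zero_prod_def)
qed

lemma is_contraction_disc_zero:
  assumes "assoc_eqs s" "disc s = 0"
  shows "is_contraction (law s) (law split_sc)"
proof (cases "s = 0")
  case True
  then show ?thesis using is_contraction_zero by simp
next
  case False
  obtain F m n where F: "invertible F" "gl_act F (law s) = law (power_sc m n)"
    using assms(1) False by (rule assoc_normal_form)
  have d: "n = 0 \<or> m^2 + 4 * n = 0"
    using disc_gl_act[OF F] assms(2) by (auto simp: disc_power_sc)
  have "is_contraction (law (power_sc m n)) (law split_sc)"
  proof (cases "n = 0")
    case True
    show ?thesis
    proof (cases "m = 0")
      assume "m = 0"
      \<comment> \<open>Both roots vanish in the limit; t and 2 t approach 0 and stay
        distinct.\<close>
      have "((\<lambda>t. t) \<longlongrightarrow> 0) (at_right (0::real))" "((\<lambda>t. 2 * t) \<longlongrightarrow> 2 * 0) (at_right (0::real))"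
        by (intro tendsto_intros)+
      then have "is_contraction (law (power_sc (0 + 2 * 0) (- (0 * (2 * 0))))) (law split_sc)"
        by (intro is_contraction_power[of "\<lambda>t. t" "\<lambda>t. 2 * t"] continuous_intros) auto
      then show ?thesis using True \<open>m = 0\<close> by simp
    next
      assume m: "m \<noteq> 0"
      \<comment> \<open>One root stays at m and the other tends to 0 from the opposite side, so they
        never meet.\<close>
      have "((\<lambda>t. - m * t) \<longlongrightarrow> - m * 0) (at_right (0::real))" "((\<lambda>t. m) \<longlongrightarrow> m) (at_right (0::real))"
        by (intro tendsto_intros)+
      moreover have "- m * t \<noteq> m" if "t > 0" for t
      proof
        assume "- m * t = m"
        then have "m * (t + 1) = 0" by (simp add: algebra_simps)
        then show False using that m by simp
      qed
      ultimately have "is_contraction (law (power_sc (- m * 0 + m) (- (- m * 0 * m)))) (law split_sc)"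
        by (intro is_contraction_power[of "\<lambda>t. - m * t" "\<lambda>t. m"] continuous_intros) (use m in auto)
      then show ?thesis using True by simp
    qed
  next
    case False
    define a where "a = m / 2"
    have n: "n = - (a * a)" using d False by (simp add: a_def power2_eq_square)
    have a: "a \<noteq> 0" using n False by auto
    \<comment> \<open>The double root a is separated by exponential factors, which keep both roots
      nonzero and distinct for every positive t.\<close>
    have "((\<lambda>t. a * exp t) \<longlongrightarrow> a * exp 0) (at_right (0::real))" "((\<lambda>t. a * exp (2 * t)) \<longlongrightarrow> a * exp (2 * 0)) (at_right (0::real))"
      by (intro tendsto_intros)+
    then have "is_contraction (law (power_sc (a * exp 0 + a * exp (2 * 0)) (- (a * exp 0 * (a * exp (2 * 0)))))) (law split_sc)"
      by (intro is_contraction_power[of "\<lambda>t. a * exp t" "\<lambda>t. a * exp (2 * t)"] continuous_intros) (use a in auto)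
    then show ?thesis by (simp add: n a_def)
  qed
  then show ?thesis
    using is_contraction_gl_act[OF _ invertible_matrix_inv[OF F(1)]] gl_act_inv[OF F] by metis
qed

subsection \<open>Dimensions\<close>

lemma Ck_on_proj:
  assumes "open V"
  shows "Ck_on k (\<lambda>x::R6. fst x $ i) V" "Ck_on k (\<lambda>x::R6. fst (snd x) $ i) V" "Ck_on k (\<lambda>x::R6. snd (snd x) $ i) V"
  by (auto intro!: Ck_on_linear assms bounded_linear_compose[OF bounded_linear_vec_nth] bounded_linear_fst bounded_linear_snd
    bounded_linear_compose[OF bounded_linear_fst] bounded_linear_compose[OF bounded_linear_snd])

lemma axis_nth_2: "axis i (1::real) $ (j::2) = (if i = j then 1 else 0)"
  by (simp add: axis_def)

lemma axis_inner_2: "axis i 1 \<bullet> (x::real^2) = x $ i"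
  by (simp add: inner_axis' )

text \<open>The minors of the matrix with rows (m, x, y) and (n, u, v). With the pivot m nonzero,
  rank at most one means that the second row is n/m times the first, and the third minor then
  vanishes by itself.\<close>

lemma minors_iff:
  fixes m :: real
  assumes "m \<noteq> 0"
  shows "m * u = x * n \<and> m * v = y * n \<and> x * v = y * u \<longleftrightarrow> u = x * n / m \<and> v = y * n / m"
proof -
  have "m * (x * v - y * u) = 0" if "m * u = x * n" "m * v = y * n"
    using that by algebra
  then have "x * v = y * u" if "m * u = x * n" "m * v = y * n"
    using that assms by simp
  then show ?thesis using assms by (auto simp: field_simps)
qed

lemma assoc_eqs_iff:
  "assoc_eqs s \<longleftrightarrow> (let a = fst s $ 1; b = fst s $ 2; c = fst (snd s) $ 1; d = fst (snd s) $ 2;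
       e = snd (snd s) $ 1; f = snd (snd s) $ 2
     in b * e = c * d \<and> b * (f - c) = (d - a) * d \<and> c * (f - c) = (d - a) * e)"
  by (cases s) (auto simp: Let_def mult.commute)

text \<open>Each of the six matrix entries serves as a pivot in turn, and two coordinates are solved
  for. In the last two cases they also occur on the right, but only inside the pivot
  \<open>d - a\<close> or \<open>f - c\<close>.\<close>

lemma minors_solve:
  fixes a b c d e f :: real
  defines "P \<equiv> b * e = c * d \<and> b * (f - c) = (d - a) * d \<and> c * (f - c) = (d - a) * e"
  shows "b \<noteq> 0 \<Longrightarrow> P \<longleftrightarrow> e = c * d / b \<and> f = c + (d - a) * d / b"
    and "c \<noteq> 0 \<Longrightarrow> P \<longleftrightarrow> d = b * e / c \<and> f = c + (b * e / c - a) * e / c"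
    and "d \<noteq> 0 \<Longrightarrow> P \<longleftrightarrow> a = d - (f - e * b / d) * b / d \<and> c = e * b / d"
    and "e \<noteq> 0 \<Longrightarrow> P \<longleftrightarrow> a = d - (f - c) * c / e \<and> b = d * c / e"
    and "d - a \<noteq> 0 \<Longrightarrow> P \<longleftrightarrow> d = b * (f - c) / (d - a) \<and> e = c * (f - c) / (d - a)"
    and "f - c \<noteq> 0 \<Longrightarrow> P \<longleftrightarrow> b = d * (d - a) / (f - c) \<and> c = e * (d - a) / (f - c)"
  unfolding P_def
  subgoal using minors_iff[of b e c d "f - c" "d - a"] by argo
  subgoal using minors_iff[of c d b e "f - c" "d - a"] by (smt (verit) mult.commute)
  subgoal using minors_iff[of d c e b "d - a" "f - c"] by (smt (verit) mult.commute)
  subgoal using minors_iff[of e b d c "d - a" "f - c"] by (smt (verit) mult.commute)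
  subgoal using minors_iff[of "d - a" d b "f - c" e c] by (smt (verit) mult.commute)
  subgoal using minors_iff[of "f - c" b d "d - a" c e] by (smt (verit) mult.commute)
  done

text \<open>The six matrix entries are linear coordinates on \<open>R6\<close>, so this is the cone
  of 2 x 3 matrices of rank at most one without its vertex. Near each point some entry is a nonzero
  pivot, and there the cone is a graph of codimension two.\<close>

lemma smooth_submanifold_assoc: "smooth_submanifold 4 {s. assoc_eqs s \<and> s \<noteq> 0}"
  unfolding smooth_submanifold_iff
proof
  fix s :: R6 assume s: "s \<in> {s. assoc_eqs s \<and> s \<noteq> 0}"
  let ?M = "{s. assoc_eqs s \<and> s \<noteq> 0}"
  let ?a = "\<lambda>x::R6. fst x $ 1" and ?b = "\<lambda>x::R6. fst x $ 2" and ?c = "\<lambda>x::R6. fst (snd x) $ 1"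
    and ?d = "\<lambda>x::R6. fst (snd x) $ 2" and ?e = "\<lambda>x::R6. snd (snd x) $ 1" and ?f = "\<lambda>x::R6. snd (snd x) $ 2"
  have D: "DIM(R6) - 2 = 4" by simp
  have op: "open {x. g x \<noteq> (0::real)}" if "continuous_on UNIV g" for g :: "R6 \<Rightarrow> real"
    using that by (intro open_Collect_neq continuous_on_const)
  note Ck = allI Ck_on_add Ck_on_diff Ck_on_minus Ck_on_mult Ck_on_divide Ck_on_proj
  note eval = axis_inner_2 inner_prod_def axis_nth_2
  have "?b s \<noteq> 0 \<or> ?c s \<noteq> 0 \<or> ?d s \<noteq> 0 \<or> ?e s \<noteq> 0 \<or> ?d s - ?a s \<noteq> 0 \<or> ?f s - ?c s \<noteq> 0"
    using s by (cases s) (auto simp: zero_prod_def vec2_eq)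
  then consider "?b s \<noteq> 0" | "?c s \<noteq> 0" | "?d s \<noteq> 0" | "?e s \<noteq> 0" | "?d s - ?a s \<noteq> 0" | "?f s - ?c s \<noteq> 0"
    by blast
  then have "slice_chart_at (DIM(R6) - 2) ?M s"
  proof cases
    case 1
    let ?V = "{x. ?b x \<noteq> 0}" and ?g1 = "\<lambda>x. ?c x * ?d x / ?b x"
      and ?g2 = "\<lambda>x. ?c x + (?d x - ?a x) * ?d x / ?b x"
      and ?n1 = "(0, 0, axis 1 1) :: R6" and ?n2 = "(0, 0, axis 2 1) :: R6"
    show ?thesis
    proof (rule slice_chart_at_graph2[of ?V ?g1 ?g2 "(0, 0, axis 1 1)" "(0, 0, axis 2 1)" ?n1 ?n2])
      show V: "open ?V"
        by (intro op continuous_intros)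
      show "Ck_on k ?g1 ?V" "Ck_on k ?g2 ?V" for k
        by (intro Ck V; simp)+
      show "x \<in> ?M \<longleftrightarrow> ?n1 \<bullet> x = ?g1 x \<and> ?n2 \<bullet> x = ?g2 x" if "x \<in> ?V" for x
      proof -
        have "x \<noteq> 0" using that by auto
        then show ?thesis
          unfolding mem_Collect_eq assoc_eqs_iff Let_def minors_solve(1)[OF that[unfolded mem_Collect_eq]]
          by (simp add: eval)
      qed
      show "s \<in> ?V" using 1 by simp
    qed (simp_all add: eval)
  next
    case 2
    let ?V = "{x. ?c x \<noteq> 0}" and ?g1 = "\<lambda>x. ?b x * ?e x / ?c x"
      and ?g2 = "\<lambda>x. ?c x + (?b x * ?e x / ?c x - ?a x) * ?e x / ?c x"
      and ?n1 = "(0, axis 2 1, 0) :: R6" and ?n2 = "(0, 0, axis 2 1) :: R6"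
    show ?thesis
    proof (rule slice_chart_at_graph2[of ?V ?g1 ?g2 "(0, axis 2 1, 0)" "(0, 0, axis 2 1)" ?n1 ?n2])
      show V: "open ?V"
        by (intro op continuous_intros)
      show "Ck_on k ?g1 ?V" "Ck_on k ?g2 ?V" for k
        by (intro Ck V; simp)+
      show "x \<in> ?M \<longleftrightarrow> ?n1 \<bullet> x = ?g1 x \<and> ?n2 \<bullet> x = ?g2 x" if "x \<in> ?V" for x
      proof -
        have "x \<noteq> 0" using that by auto
        then show ?thesis
          unfolding mem_Collect_eq assoc_eqs_iff Let_def minors_solve(2)[OF that[unfolded mem_Collect_eq]]
          by (simp add: eval)
      qed
      show "s \<in> ?V" using 2 by simp
    qed (simp_all add: eval)
  next
    case 3
    let ?V = "{x. ?d x \<noteq> 0}" and ?g1 = "\<lambda>x. ?d x - (?f x - ?e x * ?b x / ?d x) * ?b x / ?d x"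
      and ?g2 = "\<lambda>x. ?e x * ?b x / ?d x"
      and ?n1 = "(axis 1 1, 0, 0) :: R6" and ?n2 = "(0, axis 1 1, 0) :: R6"
    show ?thesis
    proof (rule slice_chart_at_graph2[of ?V ?g1 ?g2 "(axis 1 1, 0, 0)" "(0, axis 1 1, 0)" ?n1 ?n2])
      show V: "open ?V"
        by (intro op continuous_intros)
      show "Ck_on k ?g1 ?V" "Ck_on k ?g2 ?V" for k
        by (intro Ck V; simp)+
      show "x \<in> ?M \<longleftrightarrow> ?n1 \<bullet> x = ?g1 x \<and> ?n2 \<bullet> x = ?g2 x" if "x \<in> ?V" for x
      proof -
        have "x \<noteq> 0" using that by auto
        then show ?thesis
          unfolding mem_Collect_eq assoc_eqs_iff Let_def minors_solve(3)[OF that[unfolded mem_Collect_eq]]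
          by (simp add: eval)
      qed
      show "s \<in> ?V" using 3 by simp
    qed (simp_all add: eval)
  next
    case 4
    let ?V = "{x. ?e x \<noteq> 0}" and ?g1 = "\<lambda>x. ?d x - (?f x - ?c x) * ?c x / ?e x"
      and ?g2 = "\<lambda>x. ?d x * ?c x / ?e x"
      and ?n1 = "(axis 1 1, 0, 0) :: R6" and ?n2 = "(axis 2 1, 0, 0) :: R6"
    show ?thesis
    proof (rule slice_chart_at_graph2[of ?V ?g1 ?g2 "(axis 1 1, 0, 0)" "(axis 2 1, 0, 0)" ?n1 ?n2])
      show V: "open ?V"
        by (intro op continuous_intros)
      show "Ck_on k ?g1 ?V" "Ck_on k ?g2 ?V" for k
        by (intro Ck V; simp)+
      show "x \<in> ?M \<longleftrightarrow> ?n1 \<bullet> x = ?g1 x \<and> ?n2 \<bullet> x = ?g2 x" if "x \<in> ?V" for x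
      proof -
        have "x \<noteq> 0" using that by auto
        then show ?thesis
          unfolding mem_Collect_eq assoc_eqs_iff Let_def minors_solve(4)[OF that[unfolded mem_Collect_eq]]
          by (simp add: eval)
      qed
      show "s \<in> ?V" using 4 by simp
    qed (simp_all add: eval)
  next
    case 5
    let ?V = "{x. ?d x - ?a x \<noteq> 0}" and ?g1 = "\<lambda>x. ?b x * (?f x - ?c x) / (?d x - ?a x)"
      and ?g2 = "\<lambda>x. ?c x * (?f x - ?c x) / (?d x - ?a x)"
      and ?n1 = "(0, axis 2 1, 0) :: R6" and ?n2 = "(0, 0, axis 1 1) :: R6"
    show ?thesis
    \<comment> \<open>The first direction moves a and d together, which keeps the pivot d - a and
      hence both graph functions constant.\<close>
    proof (rule slice_chart_at_graph2[of ?V ?g1 ?g2 "(axis 1 1, axis 2 1, 0)" "(0, 0, axis 1 1)" ?n1 ?n2])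
      show V: "open ?V"
        by (intro op continuous_intros)
      show "Ck_on k ?g1 ?V" "Ck_on k ?g2 ?V" for k
        by (intro Ck V; simp)+
      show "x \<in> ?M \<longleftrightarrow> ?n1 \<bullet> x = ?g1 x \<and> ?n2 \<bullet> x = ?g2 x" if "x \<in> ?V" for x
      proof -
        have "x \<noteq> 0" using that by auto
        then show ?thesis
          unfolding mem_Collect_eq assoc_eqs_iff Let_def minors_solve(5)[OF that[unfolded mem_Collect_eq]]
          by (simp add: eval)
      qed
      show "s \<in> ?V" using 5 by simp
    qed (simp_all add: eval)
  next
    case 6
    let ?V = "{x. ?f x - ?c x \<noteq> 0}" and ?g1 = "\<lambda>x. ?d x * (?d x - ?a x) / (?f x - ?c x)"
      and ?g2 = "\<lambda>x. ?e x * (?d x - ?a x) / (?f x - ?c x)"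
      and ?n1 = "(axis 2 1, 0, 0) :: R6" and ?n2 = "(0, axis 1 1, 0) :: R6"
    show ?thesis
    \<comment> \<open>Likewise the second direction moves c and f together and preserves the pivot f
      - c.\<close>
    proof (rule slice_chart_at_graph2[of ?V ?g1 ?g2 "(axis 2 1, 0, 0)" "(0, axis 1 1, axis 2 1)" ?n1 ?n2])
      show V: "open ?V"
        by (intro op continuous_intros)
      show "Ck_on k ?g1 ?V" "Ck_on k ?g2 ?V" for k
        by (intro Ck V; simp)+
      show "x \<in> ?M \<longleftrightarrow> ?n1 \<bullet> x = ?g1 x \<and> ?n2 \<bullet> x = ?g2 x" if "x \<in> ?V" for x
      proof -
        have "x \<noteq> 0" using that by auto
        then show ?thesis
          unfolding mem_Collect_eq assoc_eqs_iff Let_def minors_solve(6)[OF that[unfolded mem_Collect_eq]]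
          by (simp add: eval)
      qed
      show "s \<in> ?V" using 6 by simp
    qed (simp_all add: eval)
  qed
  then show "slice_chart_at 4 ?M s" unfolding D .
qed

lemma has_orbit_dim_law: "has_orbit_dim (law ` S) d \<longleftrightarrow> smooth_submanifold d S"
  by (simp add: has_orbit_dim_def image_image)

lemma jordan_disc_sign_sets:
  "{s. law s \<in> jordan_laws \<and> disc s > 0} = {s. assoc_eqs s \<and> s \<noteq> 0} \<inter> {s. disc s > 0}"
  "{s. law s \<in> jordan_laws \<and> disc s < 0} = {s. assoc_eqs s \<and> s \<noteq> 0} \<inter> {s. disc s < 0}"
proof -
  have "law s \<in> jordan_laws \<longleftrightarrow> assoc_eqs s \<and> s \<noteq> 0" if "disc s \<noteq> 0" for s
    using that jordan_disc_nonzero[of s] jordan_law_iff[of s] by blast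
  then show "{s. law s \<in> jordan_laws \<and> disc s > 0} = {s. assoc_eqs s \<and> s \<noteq> 0} \<inter> {s. disc s > 0}"
    "{s. law s \<in> jordan_laws \<and> disc s < 0} = {s. assoc_eqs s \<and> s \<noteq> 0} \<inter> {s. disc s < 0}"
    unfolding Collect_conj_eq[symmetric] by (intro Collect_cong; metis less_irrefl)+
qed

lemma smooth_submanifold_half: "smooth_submanifold 2 {s. half_eqs s}"
proof (rule smooth_submanifold_subspace)
  have *: "half_eqs s \<longleftrightarrow> fst s $ 2 = 0 \<and> snd (snd s) $ 1 = 0 \<and> fst s $ 1 = 2 * fst (snd s) $ 2
      \<and> snd (snd s) $ 2 = 2 * fst (snd s) $ 1" for s
    by (cases s) simp
  show "subspace {s. half_eqs s}"
    by (auto simp: subspace_def *)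
  let ?u = "(vec2 2 0, vec2 0 1, 0) :: R6" and ?v = "(0, vec2 1 0, vec2 0 2) :: R6"
  have uv: "?u \<noteq> ?v" "?u \<noteq> 0" "?v \<noteq> 0"
    by (auto simp: zero_prod_def vec2_eq)
  have "orthogonal ?u ?v"
    by (simp add: orthogonal_def inner_prod_def vec2_def inner_axis axis_nth_2)
  then have "pairwise orthogonal {?u, ?v}"
    by (simp add: pairwise_insert orthogonal_commute)
  then have ind: "independent {?u, ?v}"
    using uv by (intro pairwise_orthogonal_independent) auto
  have "{s. half_eqs s} \<subseteq> span {?u, ?v}"
  proof clarify
    fix p q r assume "half_eqs (p, q, r)"
    then have "(p, q, r) = q$2 *\<^sub>R ?u + q$1 *\<^sub>R ?v" by (auto simp: vec2_eq)
    moreover have "q$2 *\<^sub>R ?u + q$1 *\<^sub>R ?v \<in> span {?u, ?v}"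
      by (intro span_add span_scale span_base) simp_all
    ultimately show "(p, q, r) \<in> span {?u, ?v}" by simp
  qed
  then show "dim {s. half_eqs s} = 2"
    using ind uv(1) by (intro dim_unique[of "{?u, ?v}"]) auto
qed

text \<open>Each orbit is the intersection of an open set with the 4-dimensional associative
  manifold or with the plane \<open>half_eqs\<close>, and inherits its dimension.\<close>

lemma orbit_dim_split: "has_orbit_dim (gl_orbit (law split_sc)) 4"
  and orbit_dim_complex: "has_orbit_dim (gl_orbit (law complex_sc)) 4"
  and orbit_dim_half: "has_orbit_dim (gl_orbit (law half_sc)) 2"
proof -
  have "{s. law s \<in> jordan_laws \<and> \<not> assoc_eqs s} = {s. half_eqs s} \<inter> {s. \<not> assoc_eqs s}"
    by (auto simp: jordan_law_iff)
  then show "has_orbit_dim (gl_orbit (law split_sc)) 4" "has_orbit_dim (gl_orbit (law complex_sc)) 4"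
    "has_orbit_dim (gl_orbit (law half_sc)) 2"
    unfolding gl_orbit_split gl_orbit_complex gl_orbit_half has_orbit_dim_law jordan_disc_sign_sets
    by (simp_all only: smooth_submanifold_Int_open smooth_submanifold_assoc smooth_submanifold_half
      open_disc_pos open_disc_neg open_nonassoc)
qed

theorem mainTheorem4:
  "\<exists>C1 C2 C3 :: (real^2 \<Rightarrow> real^2 \<Rightarrow> real^2) set.
     distinct [C1, C2, C3] \<and> open_orbits = {C1, C2, C3} \<and>
     has_orbit_dim C1 4 \<and> has_orbit_dim C2 4 \<and> has_orbit_dim C3 2 \<and>
     (\<forall>\<phi>'\<in>jordan_laws. \<phi>' \<notin> C1 \<union> C2 \<union> C3 \<longrightarrow>
        (\<exists>\<phi>\<in>C1 \<union> C2 \<union> C3. rigid \<phi> \<and> is_contraction \<phi>' \<phi>))"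
proof (intro exI conjI)
  let ?C1 = "gl_orbit (law split_sc)" and ?C2 = "gl_orbit (law complex_sc)" and ?C3 = "gl_orbit (law half_sc)"
  have inj: "law s = law t \<longleftrightarrow> s = t" for s t
    by (metis structure_constants_law)
  have mem: "law s \<in> ?C1 \<longleftrightarrow> law s \<in> jordan_laws \<and> disc s > 0"
      "law s \<in> ?C2 \<longleftrightarrow> law s \<in> jordan_laws \<and> disc s < 0"
      "law s \<in> ?C3 \<longleftrightarrow> law s \<in> jordan_laws \<and> \<not> assoc_eqs s" for s
    unfolding gl_orbit_split gl_orbit_complex gl_orbit_half by (auto simp: inj)
  have "law split_sc \<notin> ?C2" "law split_sc \<notin> ?C3" "law complex_sc \<notin> ?C3"
    unfolding mem by (simp_all add: split_sc_def complex_sc_def)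
  then have "?C1 \<noteq> ?C2" "?C1 \<noteq> ?C3" "?C2 \<noteq> ?C3"
    by (metis gl_orbit_refl)+
  then show "distinct [?C1, ?C2, ?C3]" by simp
  \<comment> \<open>Outside the three orbits a Jordan law is associative with vanishing
    discriminant, so the single rigid law \<open>law split_sc\<close> contracts to all of
    them.\<close>
  have contr: "is_contraction \<phi> (law split_sc)" if "\<phi> \<in> jordan_laws" "\<phi> \<notin> ?C1 \<union> ?C2 \<union> ?C3" for \<phi>
  proof -
    define s where "s = structure_constants \<phi>"
    have \<phi>: "\<phi> = law s" using jordan_law_structure_constants[OF that(1)] by (simp add: s_def)
    then have "assoc_eqs s" "\<not> disc s > 0" "\<not> disc s < 0"
      using that mem[of s] by simp_all
    then have "assoc_eqs s" "disc s = 0" by linarith+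
    then show ?thesis unfolding \<phi> by (rule is_contraction_disc_zero)
  qed
  show "open_orbits = {?C1, ?C2, ?C3}"
  proof
    show "{?C1, ?C2, ?C3} \<subseteq> open_orbits"
      unfolding open_orbits_def
      using split_jordan complex_jordan half_jordan open_orbit_split open_orbit_complex open_orbit_half
      by blast
    show "open_orbits \<subseteq> {?C1, ?C2, ?C3}"
    proof
      fix A assume "A \<in> open_orbits"
      then obtain \<phi> where \<phi>: "A = gl_orbit \<phi>" "\<phi> \<in> jordan_laws" "openin jordan2_topology A"
        by (auto simp: open_orbits_def)
      show "A \<in> {?C1, ?C2, ?C3}"
      proof (cases "\<phi> \<in> ?C1 \<union> ?C2 \<union> ?C3")
        case True
        then show ?thesis using gl_orbit_eq[of \<phi>] \<phi>(1) by auto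
      next
        case False
        \<comment> \<open>The orbit A is open and contains a contraction of
          \<open>law split_sc\<close>, so it meets the orbit of that law and therefore coincides
          with it.\<close>
        obtain F where "invertible F" "gl_act F (law split_sc) \<in> A"
          using contr[OF \<phi>(2) False] gl_orbit_refl[of \<phi>] \<phi>(3) unfolding \<phi>(1)
          by (rule contraction_meets_open)
        then have "gl_act F (law split_sc) \<in> gl_orbit \<phi>" "gl_act F (law split_sc) \<in> ?C1"
          using \<phi>(1) by (auto intro: gl_orbitI)
        then show ?thesis using \<phi>(1) gl_orbit_eq by (metis insertI1)
      qed
    qed
  qed
  show "\<forall>\<phi>'\<in>jordan_laws. \<phi>' \<notin> ?C1 \<union> ?C2 \<union> ?C3 \<longrightarrow>
        (\<exists>\<phi>\<in>?C1 \<union> ?C2 \<union> ?C3. rigid \<phi> \<and> is_contraction \<phi>' \<phi>)"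
  proof (intro ballI impI bexI conjI)
    show "law split_sc \<in> ?C1 \<union> ?C2 \<union> ?C3" by (simp add: gl_orbit_refl)
    show "rigid (law split_sc)" using split_jordan open_orbit_split by (simp add: rigid_def)
  qed (rule contr)
qed (rule orbit_dim_split orbit_dim_complex orbit_dim_half)+

end
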